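(* Let $X$ be a recursively compact computable metric space, $T:X\to X$ a computable map, $\lambda$ a computable reference (probability) measure on $X$, and $A$ a closed subset of $X$ which is invariant under $T$. (i) If $A$ is a topological attractor, then it is a $\Pi_2$ set. (ii) If $A$ is a metric attractor (with respect to $\lambda$), then it is a $\Pi_2$ set. (iii) If $A$ is a statistical attractor (with respect to $\lambda$), then it is a $\Sigma_2$ set. (iv) If $A$ is strongly attracting, then it is a $\Pi_1$ set. Now assume that $A$ is $\Pi_n$ with $n\in\{1,2\}$. (v) If $A$ is minimal, then it is also $\Sigma_n$. (vi) Suppose in addition that $T$ is effectively open. If the action of $T$ on $A$ is exact, then $A$ is also $\Sigma_n$.
   Context: **Computability.** A computable metric space is a triple $(X,d,\mathcal S)$ with $(X,d)$ a metric space and $\mathcal S=\{s_i:i\ge 0\}$ a countable dense subset (ideal points) such that an algorithm, on input $(i,j,n)\in\mathbb N^3$, outputs $r\in\mathbb Q$ with $|d(s_i,s_j)-r|\le 2^{-n}$. Write $B(x,r)=\{z:d(z,x)<r\}$ and $\overline B(x,r)=\{z:d(z,x)\le r\}$. Ideal balls are the balls $B(s,r)$ with $s\in\mathcal S$ and $r>0$ rational; fix a computable enumeration $(B_i)_{i\in\mathbb N}$ of them, and let $\overline{B_i}$ be the closed ball with the same center and radius as $B_i$. For $I\subset\mathbb N$ let $U_I=\bigcup_{i\in I}B_i$. A compact set $K\subset X$ is recursively compact if the inclusion $K\subset U_I$, for $I\subset\mathbb N$ finite, is semi-decidable (an algorithm given $I$ halts iff the inclusion holds). A map $T:X\to X$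 is computable if there is an algorithm which, given $m$, enumerates a set $I_m\subset\mathbb N$ with $T^{-1}(B_m)=U_{I_m}$ (such $T$ is continuous). $T$ is effectively open if there is an algorithm which, given $m$, enumerates a set $I_m\subset\mathbb N$ with $T(B_m)=U_{I_m}$. A Borel probability measure $\mu$ on $X$ is computable iff $\mu(B_{i_1}\cup\dots\cup B_{i_n})$ is lower computable uniformly in $i_1,\dots,i_n$, i.e. there is an algorithm which on input $i_1,\dots,i_n$ and $k$ outputs a rational number whose supremum over $k$ equals this measure. **Complexity of closed sets.** $\Sigma_n$ and $\Pi_n$ subsets of $\mathbb N$ are those of the usual arithmetical hierarchy. A compact set $K\subset X$ is called $\Sigma_n$ if $\{i\in\mathbb N: B_i\cap K\ne\emptyset\}$ (its inner collection) is a $\Sigma_n$ set of integers, and is called $\Pi_n$ if $\{i\in\mathbb N:\overline{B_i}\cap K=\emptyset\}$ (its outer collection) is a $\Sigma_n$ set of integers. **Attractors.** $\omega(x)$ is the set of accumulation points of $x,T(x),T^2(x),\dots$. For a closed set $A$, $\rho(A)=\{x:\omega(x)\subset A\}$. A set is generic if it contains a countable intersection of open dense sets; meager sets are complements of generic sets. A closed set $A$ is a metric attractor if $\rho(A)$ has full $\lambda$-measure and there is no strictly smaller closed set $A'\subset A$ for which $\rho(A')$ has positive $\lambda$-measure. $A$ is a topological attractor if $\rho(A)$ is generic and there is no strictly smaller closed $A'\subset A$ such that $\rho(A')$ is not meager. For $x\in X$ let $\nu_x$ be the weak* limit of $\frac1n\sum_{i<n}\delta_{T^i(x)}$, when it exists.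 A closed set $A$ is a statistical attractor if there is a unique $T$-invariant probability measure $\mu$ with $\mathrm{supp}(\mu)=A$ and $\nu_x=\mu$ for $\lambda$-almost every $x$. An attractor $A$ (of any of these three kinds) is said to be - strongly attracting if there is an open neighbourhood $U$ of $A$ such that $T(\overline U)\subset U$ and $A=\bigcap_n T^n(U)$; - minimal if the orbit of every point of $A$ is dense in $A$; - exact (equivalently, the action of $T$ on $A$ is exact) if for every ball $B$ intersecting $A$ there is $n$ with $T^n B\supset A$.
   Formalization: In (vi), "invariant under T" is taken as T^{-1}(A)=A; with only T(A)=A, (vi) fails: for the full shift on {0,1}^N every closed A is exact, yet the subshift forbidding 10^k1 for k in a c.e. non-computable set is Π_1 and not Σ_1. Parts (i)-(v) only need T(A)⊆A. *)

theory Defs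
  imports "HOL-Probability.Probability"
begin

section \<open>Algorithms\<close>

text \<open>
  Algorithms are programs for partial recursive functions.  \<open>Mn f\<close> is unbounded search for the
  least \<open>n\<close> with \<open>f (n, xs) = 0\<close>, so evaluation need not terminate.
\<close>

datatype recf = Zero | Succ | Proj nat | Comp recf "recf list" | Prec recf recf | Mn recf

inductive evaluates :: "recf \<Rightarrow> nat list \<Rightarrow> nat \<Rightarrow> bool" where
  Zero: "evaluates Zero xs 0"
| Succ: "evaluates Succ [x] (Suc x)"
| Proj: "i < length xs \<Longrightarrow> evaluates (Proj i) xs (xs ! i)"
| Comp: "list_all2 (\<lambda>g y. evaluates g xs y) gs ys \<Longrightarrow> evaluates f ys z
    \<Longrightarrow> evaluates (Comp f gs) xs z"
| Prec_0: "evaluates f xs y \<Longrightarrow> evaluates (Prec f g) (0 # xs) y"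
| Prec_Suc: "evaluates (Prec f g) (n # xs) r \<Longrightarrow> evaluates g (n # r # xs) y
    \<Longrightarrow> evaluates (Prec f g) (Suc n # xs) y"
| Mn: "evaluates f (n # xs) 0 \<Longrightarrow> (\<And>m. m < n \<Longrightarrow> \<exists>y>0. evaluates f (m # xs) y)
    \<Longrightarrow> evaluates (Mn f) xs n"

definition halts :: "recf \<Rightarrow> nat list \<Rightarrow> bool" where
  "halts p xs \<longleftrightarrow> (\<exists>y. evaluates p xs y)"

text \<open>The set listed by \<open>p\<close> on input \<open>m\<close>; the second argument is an auxiliary counter.\<close>

definition enumerated :: "recf \<Rightarrow> nat \<Rightarrow> nat set" where
  "enumerated p m = {i. \<exists>k. evaluates p [m, k] i}"

text \<open>
  A rational output is a natural number read through the enumeration \<^const>\<open>nat_to_rat_surj\<close>;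
  a finite list of inputs is passed as its code under \<^const>\<open>list_encode\<close>.
\<close>

definition rat_of_code :: "nat \<Rightarrow> real" where
  "rat_of_code n = of_rat (nat_to_rat_surj n)"

section \<open>Arithmetical hierarchy\<close>

definition decidable_rel :: "nat \<Rightarrow> (nat list \<Rightarrow> bool) \<Rightarrow> bool" where
  "decidable_rel k R \<longleftrightarrow>
     (\<exists>p. \<forall>xs. length xs = k \<longrightarrow> evaluates p xs (if R xs then 1 else 0))"

text \<open>
  \<open>Sigma_rel n k R\<close>: on lists of length \<open>k\<close>, \<open>R\<close> is given by \<open>n\<close> alternating quantifiers, the
  outermost one existential, in front of a decidable relation.
\<close>

primrec Sigma_rel :: "nat \<Rightarrow> nat \<Rightarrow> (nat list \<Rightarrow> bool) \<Rightarrow> bool" where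
  "Sigma_rel 0 k R \<longleftrightarrow> decidable_rel k R"
| "Sigma_rel (Suc n) k R \<longleftrightarrow>
     (\<exists>S. Sigma_rel n (Suc k) S \<and>
          (\<forall>xs. length xs = k \<longrightarrow> (R xs \<longleftrightarrow> (\<exists>y. \<not> S (y # xs)))))"

definition Sigma_set :: "nat \<Rightarrow> nat set \<Rightarrow> bool" where
  "Sigma_set n A \<longleftrightarrow> Sigma_rel n 1 (\<lambda>xs. hd xs \<in> A)"

section \<open>Computable metric spaces\<close>

text \<open>The space is the whole type; \<open>s\<close> enumerates the ideal points, repetitions being allowed.\<close>

definition computable_metric_space :: "(nat \<Rightarrow> 'a::metric_space) \<Rightarrow> bool" where
  "computable_metric_space s \<longleftrightarrow>
     closure (range s) = UNIV \<and>
     (\<exists>p. \<forall>i j n. \<exists>y. evaluates p [i, j, n] y \<and>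
        \<bar>dist (s i) (s j) - rat_of_code y\<bar> \<le> 1 / 2 ^ n)"

text \<open>
  The index of an ideal ball is the code of a pair (centre, radius), where the code of a pair
  \<open>(a, b)\<close> stands for the radius \<open>(a + 1) / (b + 1)\<close>; all positive rationals arise in this way.
\<close>

definition centre :: "nat \<Rightarrow> nat" where
  "centre i = fst (prod_decode i)"

definition radius :: "nat \<Rightarrow> real" where
  "radius i = (case prod_decode (snd (prod_decode i)) of (a, b) \<Rightarrow> real (Suc a) / real (Suc b))"

definition ideal_ball :: "(nat \<Rightarrow> 'a::metric_space) \<Rightarrow> nat \<Rightarrow> 'a set" where
  "ideal_ball s i = ball (s (centre i)) (radius i)"

definition ideal_cball :: "(nat \<Rightarrow> 'a::metric_space) \<Rightarrow> nat \<Rightarrow> 'a set" where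
  "ideal_cball s i = cball (s (centre i)) (radius i)"

definition recursively_compact :: "(nat \<Rightarrow> 'a::metric_space) \<Rightarrow> 'a set \<Rightarrow> bool" where
  "recursively_compact s K \<longleftrightarrow>
     compact K \<and>
     (\<exists>p. \<forall>is. halts p [list_encode is] \<longleftrightarrow> K \<subseteq> (\<Union>i\<in>set is. ideal_ball s i))"

definition computable_map :: "(nat \<Rightarrow> 'a::metric_space) \<Rightarrow> ('a \<Rightarrow> 'a) \<Rightarrow> bool" where
  "computable_map s T \<longleftrightarrow>
     (\<exists>p. \<forall>m. T -` ideal_ball s m = (\<Union>i\<in>enumerated p m. ideal_ball s i))"

definition effectively_open :: "(nat \<Rightarrow> 'a::metric_space) \<Rightarrow> ('a \<Rightarrow> 'a) \<Rightarrow> bool" where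
  "effectively_open s T \<longleftrightarrow>
     (\<exists>p. \<forall>m. T ` ideal_ball s m = (\<Union>i\<in>enumerated p m. ideal_ball s i))"

definition borel_prob :: "'a::topological_space measure \<Rightarrow> bool" where
  "borel_prob M \<longleftrightarrow> prob_space M \<and> sets M = sets borel"

text \<open>The supremum is taken in the extended reals, so that it is meaningful without a bound.\<close>

definition computable_measure :: "(nat \<Rightarrow> 'a::metric_space) \<Rightarrow> 'a measure \<Rightarrow> bool" where
  "computable_measure s M \<longleftrightarrow>
     borel_prob M \<and>
     (\<exists>p f. (\<forall>is k. evaluates p [list_encode is, k] (f is k)) \<and>
        (\<forall>is. (SUP k. ereal (rat_of_code (f is k))) =
               ereal (measure M (\<Union>i\<in>set is. ideal_ball s i))))"

definition Sigma_compact :: "(nat \<Rightarrow> 'a::metric_space) \<Rightarrow> nat \<Rightarrow> 'a set \<Rightarrow> bool" where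
  "Sigma_compact s n K \<longleftrightarrow> compact K \<and> Sigma_set n {i. ideal_ball s i \<inter> K \<noteq> {}}"

definition Pi_compact :: "(nat \<Rightarrow> 'a::metric_space) \<Rightarrow> nat \<Rightarrow> 'a set \<Rightarrow> bool" where
  "Pi_compact s n K \<longleftrightarrow> compact K \<and> Sigma_set n {i. ideal_cball s i \<inter> K = {}}"

section \<open>Attractors\<close>

text \<open>
  Accumulation points are those of the orbit as a sequence, not of its set of values: the orbit
  enters every neighbourhood at infinitely many times.
\<close>

definition omega_limit :: "('a \<Rightarrow> 'a) \<Rightarrow> 'a::topological_space \<Rightarrow> 'a set" where
  "omega_limit T x =
     {y. \<forall>U. open U \<and> y \<in> U \<longrightarrow> (\<exists>\<^sub>F n in sequentially. (T ^^ n) x \<in> U)}"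

definition realm :: "('a \<Rightarrow> 'a) \<Rightarrow> 'a::topological_space set \<Rightarrow> 'a set" where
  "realm T A = {x. omega_limit T x \<subseteq> A}"

definition generic :: "'a::topological_space set \<Rightarrow> bool" where
  "generic S \<longleftrightarrow>
     (\<exists>G :: nat \<Rightarrow> 'a set. (\<forall>n. open (G n) \<and> closure (G n) = UNIV) \<and> (\<Inter>n. G n) \<subseteq> S)"

definition meager :: "'a::topological_space set \<Rightarrow> bool" where
  "meager S \<longleftrightarrow> generic (- S)"

definition topological_attractor :: "('a \<Rightarrow> 'a) \<Rightarrow> 'a::topological_space set \<Rightarrow> bool" where
  "topological_attractor T A \<longleftrightarrow>
     closed A \<and> generic (realm T A) \<and>
     \<not> (\<exists>A'. closed A' \<and> A' \<subset> A \<and> \<not> meager (realm T A'))"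

definition metric_attractor ::
    "'a::topological_space measure \<Rightarrow> ('a \<Rightarrow> 'a) \<Rightarrow> 'a set \<Rightarrow> bool" where
  "metric_attractor M T A \<longleftrightarrow>
     closed A \<and> measure M (realm T A) = 1 \<and>
     \<not> (\<exists>A'. closed A' \<and> A' \<subset> A \<and> measure M (realm T A') > 0)"

definition measure_support :: "'a::topological_space measure \<Rightarrow> 'a set" where
  "measure_support M = {x. \<forall>U. open U \<and> x \<in> U \<longrightarrow> measure M U > 0}"

definition invariant_measure :: "('a \<Rightarrow> 'a) \<Rightarrow> 'a::topological_space measure \<Rightarrow> bool" where
  "invariant_measure T M \<longleftrightarrow> T \<in> M \<rightarrow>\<^sub>M M \<and> distr M M T = M"

text \<open>The average of the Dirac masses at \<open>x, T x, \<dots>, T\<^sup>n\<^sup>-\<^sup>1 x\<close>, for \<open>n \<ge> 1\<close>.\<close>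

definition empirical_measure ::
    "('a \<Rightarrow> 'a) \<Rightarrow> 'a::topological_space \<Rightarrow> nat \<Rightarrow> 'a measure" where
  "empirical_measure T x n = distr (uniform_count_measure {..<n}) borel (\<lambda>i. (T ^^ i) x)"

definition weak_star_limit ::
    "(nat \<Rightarrow> 'a::topological_space measure) \<Rightarrow> 'a measure \<Rightarrow> bool" where
  "weak_star_limit N M \<longleftrightarrow>
     (\<forall>f :: 'a \<Rightarrow> real. continuous_on UNIV f \<and> bounded (range f) \<longrightarrow>
        (\<lambda>n. integral\<^sup>L (N n) f) \<longlonglongrightarrow> integral\<^sup>L M f)"

definition statistical_attractor ::
    "'a::topological_space measure \<Rightarrow> ('a \<Rightarrow> 'a) \<Rightarrow> 'a set \<Rightarrow> bool" where
  "statistical_attractor L T A \<longleftrightarrow>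
     closed A \<and>
     (\<exists>!M. borel_prob M \<and> invariant_measure T M \<and> measure_support M = A \<and>
           (AE x in L. weak_star_limit (empirical_measure T x) M))"

definition strongly_attracting :: "('a \<Rightarrow> 'a) \<Rightarrow> 'a::topological_space set \<Rightarrow> bool" where
  "strongly_attracting T A \<longleftrightarrow>
     (\<exists>U. open U \<and> A \<subseteq> U \<and> T ` closure U \<subseteq> U \<and> A = (\<Inter>n. (T ^^ n) ` U))"

definition minimal_on :: "('a \<Rightarrow> 'a) \<Rightarrow> 'a::topological_space set \<Rightarrow> bool" where
  "minimal_on T A \<longleftrightarrow> (\<forall>x\<in>A. A \<subseteq> closure (range (\<lambda>n. (T ^^ n) x)))"

text \<open>
  The image of the whole ball is taken, not only of its trace on \<open>A\<close>, so points of \<open>A\<close> may be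
  reached from outside \<open>A\<close> unless \<open>T -` A \<subseteq> A\<close>.
\<close>

definition exact_on :: "('a \<Rightarrow> 'a) \<Rightarrow> 'a::metric_space set \<Rightarrow> bool" where
  "exact_on T A \<longleftrightarrow>
     (\<forall>x r. r > 0 \<and> ball x r \<inter> A \<noteq> {} \<longrightarrow> (\<exists>n. A \<subseteq> (T ^^ n) ` ball x r))"

end

theory Submission
  imports Defs
begin

text \<open>
  Each attracting set is described by a formula over ideal balls whose complexity can be read off.
  Closed balls can be compared with effective unions of balls because \<open>X\<close> is recursively compact, and
  \<open>T\<^sup>-\<^sup>k(B)\<close> is such a union, uniformly in \<open>k\<close>.

  Let \<open>O\<^sub>n\<close> be the set of points visiting a ball \<open>B\<close> at some time \<open>k \<ge> n\<close>.  For a topological attractor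
  \<open>A\<close> there is a dichotomy: if \<open>B\<close> meets \<open>A\<close>, minimality makes every \<open>O\<^sub>n\<close> dense, and if the closed
  ball misses \<open>A\<close>, some \<open>O\<^sub>n\<close> misses an open set, by Baire.  For a metric attractor the same holds with
  \<open>\<lambda>(O\<^sub>n) = 1\<close> against \<open>\<lambda>(O\<^sub>n) \<le> 1/2\<close>.  A ball meets a statistical attractor iff, for some \<open>\<epsilon> > 0\<close>, the orbit of
  at least half of the points spends a proportion \<open>\<ge> \<epsilon>\<close> of any sufficiently long time in a smaller concentric
  closed ball.  A strongly attracting set is the decreasing intersection of the images of a finite
  union of closed ideal balls.  Finally, a ball meets a minimal (exact) set \<open>A\<close> iff its preimages
  (images) cover \<open>A\<close>, and inclusion of \<open>A\<close> in an effective open set is as complex as the outer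
  collection of \<open>A\<close>.
\<close>

section \<open>Computable functions\<close>

text \<open>Each algorithm in the hypotheses is one fixed program, so graphs of programs are shown
  to be Sigma_1 by induction on the program, one program at a time, rather than through a universal
  machine. In the same way, finite data that merely exist, such as a cover of a trapping region, may
  be built into a formula: the collection of indices must be Sigma_n, but nothing has to be found
  uniformly in \<open>A\<close>. What can be verified is always strict and one-sided: a real number
  exceeds a rational, a compact set lies in an open one, an open set has measure above a bound.
  Three obstacles follow. A ball may touch \<open>A\<close> only along its bounding sphere, so the
  two halves of a dichotomy speak of open and of closed balls, and a small change of radius closes
  the gap. Weak* convergence says nothing about indicators of balls, so continuous functions are
  squeezed between concentric balls. Upper bounds on a visit frequency become verifiable only when
  restated as lower bounds on the number of times at which a closed ball is avoided.\<close>

inductive_cases evaluates_ZeroE: "evaluates Zero xs y"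
inductive_cases evaluates_SuccE: "evaluates Succ xs y"
inductive_cases evaluates_ProjE: "evaluates (Proj i) xs y"
inductive_cases evaluates_CompE: "evaluates (Comp f gs) xs y"
inductive_cases evaluates_Prec_0E: "evaluates (Prec f g) (0 # xs) y"
inductive_cases evaluates_Prec_SucE: "evaluates (Prec f g) (Suc n # xs) y"
inductive_cases evaluates_PrecE: "evaluates (Prec f g) xs y"
inductive_cases evaluates_MnE: "evaluates (Mn f) xs y"

text \<open>The hypotheses promise that some output has a given property. Since outputs are unique,
  every value found by searching through the graph of a program has it too.\<close>

lemma evaluates_deterministic: "evaluates p xs y \<Longrightarrow> evaluates p xs z \<Longrightarrow> y = z"
proof (induction p xs y arbitrary: z rule: evaluates.induct)
  case (Zero xs)
  then show ?case by (auto elim: evaluates_ZeroE)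
next
  case (Succ x)
  then show ?case by (auto elim: evaluates_SuccE)
next
  case (Proj i xs)
  then show ?case by (auto elim: evaluates_ProjE)
next
  case (Comp xs gs ys f w)
  from Comp.prems obtain ys' where ys': "list_all2 (\<lambda>g y. evaluates g xs y) gs ys'" "evaluates f ys' z"
    by (auto elim: evaluates_CompE)
  have "ys = ys'"
  proof (rule nth_equalityI)
    show len: "length ys = length ys'"
      using list_all2_lengthD[OF Comp.IH(1)] list_all2_lengthD[OF ys'(1)] by simp
    show "ys ! i = ys' ! i" if "i < length ys" for i
      using list_all2_nthD2[OF Comp.IH(1), of i] list_all2_nthD2[OF ys'(1), of i] len that by simp
  qed
  then show ?case using Comp.IH(2) ys'(2) by blast
next
  case (Prec_0 f xs y g)
  from Prec_0.prems have "evaluates f xs z" by (rule evaluates_Prec_0E)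
  then show ?case by (rule Prec_0.IH)
next
  case (Prec_Suc f g n xs r y)
  from Prec_Suc.prems obtain r' where "evaluates (Prec f g) (n # xs) r'" "evaluates g (n # r' # xs) z"
    by (auto elim: evaluates_Prec_SucE)
  with Prec_Suc.IH show ?case by blast
next
  case (Mn f n xs)
  from Mn.prems have z: "evaluates f (z # xs) 0" "\<And>m. m < z \<Longrightarrow> \<exists>y>0. evaluates f (m # xs) y"
    by (auto elim: evaluates_MnE)
  have "\<not> z < n" using Mn.IH(2) z(1) by blast
  moreover have "\<not> n < z" using Mn.IH(1) z(2) by blast
  ultimately show ?case by simp
qed

definition computable_on :: "nat \<Rightarrow> (nat list \<Rightarrow> nat) \<Rightarrow> bool" where
  "computable_on k f \<longleftrightarrow> (\<exists>p. \<forall>xs. length xs = k \<longrightarrow> evaluates p xs (f xs))"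

lemma computable_on_cong:
  "computable_on k f \<Longrightarrow> (\<And>xs. length xs = k \<Longrightarrow> f xs = g xs) \<Longrightarrow> computable_on k g"
  unfolding computable_on_def by metis

lemma computable_on_nth: "i < k \<Longrightarrow> computable_on k (\<lambda>xs. xs ! i)"
  unfolding computable_on_def by (metis evaluates.Proj)

lemma computable_on_compose:
  assumes "computable_on (length gs) f" "\<And>g. g \<in> set gs \<Longrightarrow> computable_on k g"
  shows "computable_on k (\<lambda>xs. f (map (\<lambda>g. g xs) gs))"
proof -
  obtain p where p: "\<And>xs. length xs = length gs \<Longrightarrow> evaluates p xs (f xs)"
    using assms(1) unfolding computable_on_def by blast
  have "\<forall>g\<in>set gs. \<exists>q. \<forall>xs. length xs = k \<longrightarrow> evaluates q xs (g xs)"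
    using assms(2) unfolding computable_on_def by blast
  then obtain Q where Q: "\<And>g xs. g \<in> set gs \<Longrightarrow> length xs = k \<Longrightarrow> evaluates (Q g) xs (g xs)"
    by metis
  have "evaluates (Comp p (map Q gs)) xs (f (map (\<lambda>g. g xs) gs))" if "length xs = k" for xs
    by (rule evaluates.Comp[where ys = "map (\<lambda>g. g xs) gs"])
      (use Q p that in \<open>auto simp: list_all2_conv_all_nth\<close>)
  then show ?thesis unfolding computable_on_def by blast
qed

lemma computable_on_compose1:
  "computable_on 1 f \<Longrightarrow> computable_on k g \<Longrightarrow> computable_on k (\<lambda>xs. f [g xs])"
  using computable_on_compose[of "[g]" f k] by simp

lemma computable_on_0: "computable_on k (\<lambda>xs. 0)"
  unfolding computable_on_def by (metis evaluates.Zero)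

lemma computable_on_Suc:
  assumes "computable_on k f" shows "computable_on k (\<lambda>xs. Suc (f xs))"
proof -
  have "computable_on 1 (\<lambda>xs. Suc (hd xs))"
    unfolding computable_on_def by (rule exI[of _ Succ]) (auto simp: length_Suc_conv intro: evaluates.Succ)
  from computable_on_compose1[OF this assms] show ?thesis by simp
qed

lemma computable_on_const: "computable_on k (\<lambda>xs. n)"
  by (induction n) (auto intro: computable_on_0 computable_on_Suc)

lemma computable_on_drop2:
  assumes "computable_on k f" shows "computable_on (Suc (Suc k)) (\<lambda>xs. f (tl (tl xs)))"
proof -
  have "computable_on (Suc (Suc k))
     (\<lambda>xs. f (map (\<lambda>g. g xs) (map (\<lambda>i xs. xs ! Suc (Suc i)) [0..<k])))"
    by (rule computable_on_compose) (use assms in \<open>auto intro: computable_on_nth\<close>)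
  then show ?thesis
    by (rule computable_on_cong)
      (auto simp: nth_tl length_Suc_conv comp_def intro!: arg_cong[of _ _ f] nth_equalityI)
qed

lemma computable_on_rec:
  assumes "computable_on k f" "computable_on (Suc (Suc k)) g" "computable_on k b"
  shows "computable_on k (\<lambda>xs. rec_nat (f xs) (\<lambda>n r. g (n # r # xs)) (b xs))"
proof -
  obtain p q where p: "\<And>xs. length xs = k \<Longrightarrow> evaluates p xs (f xs)"
    and q: "\<And>xs. length xs = Suc (Suc k) \<Longrightarrow> evaluates q xs (g xs)"
    using assms unfolding computable_on_def by metis
  have "evaluates (Prec p q) (n # xs) (rec_nat (f xs) (\<lambda>n r. g (n # r # xs)) n)"
    if "length xs = k" for n xs
    by (induction n) (use p q that in \<open>auto intro!: evaluates.Prec_0 intro: evaluates.Prec_Suc\<close>)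
  then have *: "computable_on (Suc k) (\<lambda>xs. rec_nat (f (tl xs)) (\<lambda>n r. g (n # r # tl xs)) (hd xs))"
    unfolding computable_on_def by (intro exI[of _ "Prec p q"]) (auto simp: length_Suc_conv)
  \<comment> \<open>\<open>Prec\<close> recurses on its first argument. Composing with
    \<open>b\<close> followed by all projections lets the number of steps depend on the remaining
    arguments.\<close>
  let ?gs = "b # map (\<lambda>i xs. xs ! i) [0..<k]"
  have "computable_on k (\<lambda>xs. (\<lambda>xs. rec_nat (f (tl xs)) (\<lambda>n r. g (n # r # tl xs)) (hd xs))
      (map (\<lambda>g. g xs) ?gs))"
    by (rule computable_on_compose) (use * assms in \<open>auto intro: computable_on_nth\<close>)
  moreover have "map (\<lambda>g. g xs) (map (\<lambda>i xs. xs ! i) [0..<k]) = xs" if "length xs = k" for xs :: "nat list"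
    using that by (auto intro!: nth_equalityI)
  ultimately show ?thesis by (auto intro: computable_on_cong)
qed

lemma computable_on_Least:
  assumes "computable_on (Suc k) f" "\<And>xs. length xs = k \<Longrightarrow> \<exists>n. f (n # xs) = 0"
  shows "computable_on k (\<lambda>xs. LEAST n. f (n # xs) = 0)"
proof -
  obtain p where p: "\<And>xs. length xs = Suc k \<Longrightarrow> evaluates p xs (f xs)"
    using assms unfolding computable_on_def by metis
  have "evaluates (Mn p) xs (LEAST n. f (n # xs) = 0)" if xs: "length xs = k" for xs
  proof (rule evaluates.Mn)
    have "f ((LEAST n. f (n # xs) = 0) # xs) = 0"
      using assms(2)[OF xs] by (rule LeastI_ex)
    then show "evaluates p ((LEAST n. f (n # xs) = 0) # xs) 0"
      using p xs by (metis length_Cons)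
    show "\<exists>y>0. evaluates p (m # xs) y" if "m < (LEAST n. f (n # xs) = 0)" for m
      using not_less_Least[OF that] p[of "m # xs"] xs by auto
  qed
  then show ?thesis unfolding computable_on_def by blast
qed

lemma computable_on_add:
  assumes "computable_on k f" "computable_on k g"
  shows "computable_on k (\<lambda>xs. f xs + g xs)"
proof -
  have "rec_nat a (\<lambda>n r. Suc r) b = a + b" for a b :: nat by (induction b) auto
  then show ?thesis
    using computable_on_rec[OF assms(1) computable_on_Suc[OF computable_on_nth[of 1]] assms(2)]
    by simp
qed

lemma computable_on_mult:
  assumes "computable_on k f" "computable_on k g"
  shows "computable_on k (\<lambda>xs. f xs * g xs)"
proof -
  have "rec_nat 0 (\<lambda>n r. r + a) b = a * b" for a b :: nat by (induction b) auto
  then show ?thesis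
    using computable_on_rec[OF computable_on_0 computable_on_add[OF computable_on_nth[of 1]
      computable_on_drop2[OF assms(1)]] assms(2)]
    by simp
qed

lemma computable_on_diff:
  assumes "computable_on k f" "computable_on k g"
  shows "computable_on k (\<lambda>xs. f xs - g xs)"
proof -
  have pred: "computable_on k (\<lambda>xs. h xs - 1)" if "computable_on k h" for k h
  proof -
    have "rec_nat 0 (\<lambda>n r. n) b = b - 1" for b :: nat by (induction b) auto
    then show ?thesis
      using computable_on_rec[OF computable_on_0 computable_on_nth[of 0] that] by simp
  qed
  have "rec_nat a (\<lambda>n r. r - 1) b = a - b" for a b :: nat by (induction b) auto
  then show ?thesis
    using computable_on_rec[OF assms(1) pred[OF computable_on_nth[of 1]] assms(2)]
    by simp
qed

lemma computable_on_triangle: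
  assumes "computable_on k f" shows "computable_on k (\<lambda>xs. triangle (f xs))"
proof -
  have "rec_nat 0 (\<lambda>n r. r + Suc n) b = triangle b" for b :: nat by (induction b) auto
  then show ?thesis
    using computable_on_rec[OF computable_on_0 computable_on_add[OF computable_on_nth[of 1]
      computable_on_Suc[OF computable_on_nth[of 0]]] assms]
    by simp
qed

lemma computable_on_prod_encode:
  assumes "computable_on k f" "computable_on k g"
  shows "computable_on k (\<lambda>xs. prod_encode (f xs, g xs))"
  unfolding prod_encode_def using assms
  by (auto intro!: computable_on_add computable_on_triangle)

lemma triangle_mono: "m \<le> n \<Longrightarrow> triangle m \<le> triangle n"
  by (induction n rule: dec_induct) auto

text \<open>\<open>prod_encode (a, b)\<close> is \<open>triangle (a + b) + a\<close>, so
  \<open>a + b\<close> is the number of the diagonal containing \<open>z\<close>. As a minimization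
  it makes decoding computable; a truncated difference equal to 0 serves as the test for
  \<le>.\<close>

lemma fst_plus_snd_prod_decode:
  "fst (prod_decode z) + snd (prod_decode z) = (LEAST w. Suc z - triangle (Suc w) = 0)"
proof -
  obtain a b where ab: "prod_decode z = (a, b)" by fastforce
  then have z: "z = triangle (a + b) + a"
    using prod_decode_inverse[of z] by (simp add: prod_encode_def)
  have "(LEAST w. Suc z - triangle (Suc w) = 0) = a + b"
  proof (rule Least_equality)
    show "Suc z - triangle (Suc (a + b)) = 0" using z by simp
    fix w assume w: "Suc z - triangle (Suc w) = 0"
    show "a + b \<le> w"
    proof (rule ccontr)
      assume "\<not> a + b \<le> w"
      then have "triangle (Suc w) \<le> triangle (a + b)" by (intro triangle_mono) simp
      with w z show False by (simp del: triangle_Suc)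
    qed
  qed
  then show ?thesis using ab by simp
qed

lemma computable_on_prod_decode:
  assumes "computable_on k f"
  shows "computable_on k (\<lambda>xs. fst (prod_decode (f xs)))" "computable_on k (\<lambda>xs. snd (prod_decode (f xs)))"
proof -
  have "triangle n \<ge> n" for n by (induction n) auto
  then have "\<exists>n. Suc z - triangle (Suc n) = 0" for z
    by (metis diff_is_0_eq)
  then have s: "computable_on 1 (\<lambda>xs. fst (prod_decode (xs ! 0)) + snd (prod_decode (xs ! 0)))"
    unfolding fst_plus_snd_prod_decode
    using computable_on_Least[of 1 "\<lambda>ys. Suc (ys ! 1) - triangle (Suc (ys ! 0))",
      OF computable_on_diff[OF computable_on_Suc[OF computable_on_nth]
        computable_on_triangle[OF computable_on_Suc[OF computable_on_nth]]]]
    by (simp del: triangle_Suc diff_is_0_eq)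
  have *: "z = triangle (fst (prod_decode z) + snd (prod_decode z)) + fst (prod_decode z)" for z
    using prod_decode_inverse[of z] by (simp add: prod_encode_def case_prod_beta)
  have "fst (prod_decode z) = z - triangle (fst (prod_decode z) + snd (prod_decode z))" for z
    using *[of z] by simp
  then have f: "computable_on 1 (\<lambda>xs. fst (prod_decode (xs ! 0)))"
    using s by (metis (mono_tags, lifting) computable_on_cong computable_on_diff computable_on_triangle computable_on_nth less_one)
  have "snd (prod_decode z) = (fst (prod_decode z) + snd (prod_decode z)) - fst (prod_decode z)" for z
    by simp
  then have g: "computable_on 1 (\<lambda>xs. snd (prod_decode (xs ! 0)))"
    using computable_on_diff[OF s f] by simp
  show "computable_on k (\<lambda>xs. fst (prod_decode (f xs)))" "computable_on k (\<lambda>xs. snd (prod_decode (f xs)))"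
    using computable_on_compose1[OF f assms] computable_on_compose1[OF g assms] by simp_all
qed

text \<open>
  All relations below are unary: an environment is a natural number, variables are read off
  it with \<^const>\<open>prod_decode\<close>, and a quantifier over \<open>y\<close> in the environment \<open>e\<close> leads to the
  environment \<open>prod_encode (y, e)\<close>.
\<close>

definition computable :: "(nat \<Rightarrow> nat) \<Rightarrow> bool" where
  "computable f \<longleftrightarrow> computable_on 1 (\<lambda>xs. f (xs ! 0))"

definition decidable :: "(nat \<Rightarrow> bool) \<Rightarrow> bool" where
  "decidable P \<longleftrightarrow> computable (\<lambda>e. if P e then 1 else 0)"

named_theorems computable_intros
named_theorems decidable_intros

lemma computable_on_computable:
  assumes "computable f" "computable_on k g" shows "computable_on k (\<lambda>xs. f (g xs))"
  using computable_on_compose1[OF assms(1)[unfolded computable_def] assms(2)] by simp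

lemma computable_compose: "computable f \<Longrightarrow> computable g \<Longrightarrow> computable (\<lambda>e. f (g e))"
  unfolding computable_def[of g] computable_def[of "\<lambda>e. f (g e)"]
  by (rule computable_on_computable)

lemma computable_basic [computable_intros]:
  "computable (\<lambda>e. e)"
  "computable (\<lambda>e. c)"
  "computable f \<Longrightarrow> computable (\<lambda>e. Suc (f e))"
  "computable f \<Longrightarrow> computable g \<Longrightarrow> computable (\<lambda>e. f e + g e)"
  "computable f \<Longrightarrow> computable g \<Longrightarrow> computable (\<lambda>e. f e * g e)"
  "computable f \<Longrightarrow> computable g \<Longrightarrow> computable (\<lambda>e. f e - g e)"
  "computable f \<Longrightarrow> computable g \<Longrightarrow> computable (\<lambda>e. prod_encode (f e, g e))"
  "computable f \<Longrightarrow> computable (\<lambda>e. fst (prod_decode (f e)))"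
  "computable f \<Longrightarrow> computable (\<lambda>e. snd (prod_decode (f e)))"
  unfolding computable_def
  by (auto intro: computable_on_nth computable_on_const computable_on_Suc computable_on_add
      computable_on_mult computable_on_diff computable_on_prod_encode computable_on_prod_decode)

text \<open>Computability is a unary notion, so the step function is judged on nested pairs (index,
  (previous value, environment)).\<close>

lemma computable_rec_nat [computable_intros]:
  assumes "computable f"
    and "computable (\<lambda>p. g (fst (prod_decode p)) (fst (prod_decode (snd (prod_decode p))))
                          (snd (prod_decode (snd (prod_decode p)))))"
    and "computable b"
  shows "computable (\<lambda>e. rec_nat (f e) (\<lambda>n r. g n r e) (b e))"
proof -
  have "computable_on 3 (\<lambda>ys. (\<lambda>p. g (fst (prod_decode p)) (fst (prod_decode (snd (prod_decode p))))
                          (snd (prod_decode (snd (prod_decode p)))))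
      (prod_encode (ys ! 0, prod_encode (ys ! 1, ys ! 2))))"
    by (rule computable_on_computable[OF assms(2)]) (auto intro!: computable_on_prod_encode computable_on_nth)
  then have "computable_on (Suc (Suc 1)) (\<lambda>ys. g (ys ! 0) (ys ! 1) (ys ! 2))"
    by (simp add: numeral_eq_Suc)
  from computable_on_rec[OF assms(1)[unfolded computable_def] this assms(3)[unfolded computable_def]]
  show ?thesis unfolding computable_def by (simp add: numeral_2_eq_2)
qed

lemma computable_if [computable_intros]:
  assumes "decidable P" "computable f" "computable g"
  shows "computable (\<lambda>e. if P e then f e else g e)"
proof -
  have "computable (\<lambda>e. (if P e then 1 else 0) * f e + (1 - (if P e then 1 else 0)) * g e)"
    using assms unfolding decidable_def by (intro computable_basic)
  moreover have "(\<lambda>e. (if P e then 1 else 0) * f e + (1 - (if P e then 1 else 0)) * g e) =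
    (\<lambda>e. if P e then f e else g e)"
    by auto
  ultimately show ?thesis by metis
qed

lemma decidable_compose: "decidable P \<Longrightarrow> computable f \<Longrightarrow> decidable (\<lambda>e. P (f e))"
  unfolding decidable_def by (rule computable_compose)

lemma decidable_const [decidable_intros]: "decidable (\<lambda>e. c)"
  unfolding decidable_def by (rule computable_basic)

lemma decidable_not [decidable_intros]:
  assumes "decidable P" shows "decidable (\<lambda>e. \<not> P e)"
proof -
  have "computable (\<lambda>e. if P e then 0 else 1)"
    by (intro computable_intros assms)
  moreover have "(\<lambda>e. if P e then 0 else 1 :: nat) = (\<lambda>e. if \<not> P e then 1 else 0)"
    by auto
  ultimately show ?thesis unfolding decidable_def by metis
qed

lemma decidable_conj [decidable_intros]:
  assumes "decidable P" "decidable Q" shows "decidable (\<lambda>e. P e \<and> Q e)"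
proof -
  have "computable (\<lambda>e. if P e then if Q e then 1 else 0 else 0)"
    by (intro computable_intros assms)
  moreover have "(\<lambda>e. if P e then if Q e then 1 else 0 else 0 :: nat) = (\<lambda>e. if P e \<and> Q e then 1 else 0)"
    by auto
  ultimately show ?thesis unfolding decidable_def by metis
qed

lemma decidable_disj [decidable_intros]:
  assumes "decidable P" "decidable Q" shows "decidable (\<lambda>e. P e \<or> Q e)"
proof -
  have "decidable (\<lambda>e. \<not> (\<not> P e \<and> \<not> Q e))"
    by (intro decidable_intros assms)
  then show ?thesis by simp
qed

lemma decidable_le [decidable_intros]:
  assumes "computable f" "computable g" shows "decidable (\<lambda>e. f e \<le> g e)"
proof -
  have "computable (\<lambda>e. 1 - (f e - g e))"
    by (intro computable_intros assms)
  moreover have "(\<lambda>e. 1 - (f e - g e)) = (\<lambda>e. if f e \<le> g e then 1 else 0)"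
    by auto
  ultimately show ?thesis unfolding decidable_def by metis
qed

lemma decidable_less [decidable_intros]:
  assumes "computable f" "computable g" shows "decidable (\<lambda>e. f e < g e)"
proof -
  have "decidable (\<lambda>e. Suc (f e) \<le> g e)"
    by (intro decidable_intros computable_intros assms)
  then show ?thesis by (simp add: Suc_le_eq)
qed

lemma decidable_eq [decidable_intros]:
  fixes f g :: "nat \<Rightarrow> nat"
  assumes "computable f" "computable g" shows "decidable (\<lambda>e. f e = g e)"
proof -
  have "decidable (\<lambda>e. f e \<le> g e \<and> g e \<le> f e)"
    by (intro decidable_intros assms)
  then show ?thesis by (simp add: order_eq_iff)
qed

text \<open>The truth value is the accumulator of a primitive recursion: it starts at 1 and drops to
  0 for good at the first failure.\<close>

lemma decidable_all_less [decidable_intros]: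
  assumes "decidable (\<lambda>p. P (fst (prod_decode p)) (snd (prod_decode p)))" "computable b"
  shows "decidable (\<lambda>e. \<forall>y<b e. P y e)"
proof -
  \<comment> \<open>The recursion presents its data as (index, (accumulator, environment)); this
    reindexing skips the accumulator.\<close>
  have "decidable (\<lambda>p. P (fst (prod_decode p)) (snd (prod_decode (snd (prod_decode p)))))"
    using decidable_compose[OF assms(1), of "\<lambda>p. prod_encode (fst (prod_decode p), snd (prod_decode (snd (prod_decode p))))"]
    by (simp add: computable_intros)
  then have "computable (\<lambda>e. rec_nat 1 (\<lambda>n r. if P n e then r else 0) (b e))"
    by (intro computable_intros assms)
  moreover have "rec_nat 1 (\<lambda>n r. if P n e then r else 0) b = (if \<forall>y<b. P y e then 1 else 0::nat)" for e b
    by (induction b) (auto simp: less_Suc_eq)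
  ultimately show ?thesis unfolding decidable_def by simp
qed

lemma decidable_ex_less [decidable_intros]:
  assumes "decidable (\<lambda>p. P (fst (prod_decode p)) (snd (prod_decode p)))" "computable b"
  shows "decidable (\<lambda>e. \<exists>y<b e. P y e)"
proof -
  have "decidable (\<lambda>e. \<not> (\<forall>y<b e. \<not> P y e))"
    by (intro decidable_intros assms)
  then show ?thesis by simp
qed

lemma computable_Least [computable_intros]:
  assumes "decidable (\<lambda>p. P (fst (prod_decode p)) (snd (prod_decode p)))" "\<And>e. \<exists>n. P n e"
  shows "computable (\<lambda>e. LEAST n. P n e)"
proof -
  have "computable (\<lambda>p. if P (fst (prod_decode p)) (snd (prod_decode p)) then 0 else 1)" (is "computable ?f")
    by (intro computable_intros assms)
  then have "computable_on 2 (\<lambda>xs. ?f (prod_encode (xs ! 0, xs ! 1)))"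
    by (rule computable_on_computable) (auto intro!: computable_on_prod_encode computable_on_nth)
  then have "computable_on (Suc 1) (\<lambda>xs. if P (xs ! 0) (xs ! 1) then 0 else 1)"
    by (simp add: numeral_2_eq_2)
  moreover have "(if b then 0 else 1) = (0::nat) \<longleftrightarrow> b" for b by simp
  ultimately show ?thesis
    using computable_on_Least[of 1 "\<lambda>xs. if P (xs ! 0) (xs ! 1) then 0 else 1"] assms(2)
    by (simp only: computable_def nth_Cons_0 One_nat_def nth_Cons_Suc)
qed

lemma computable_div2 [computable_intros]:
  assumes "computable f" shows "computable (\<lambda>e. f e div 2)"
proof -
  have "computable (\<lambda>e. LEAST n. e < 2 * Suc n)"
    by (intro computable_intros decidable_intros) presburger
  moreover have "(LEAST n. e < 2 * Suc n) = e div 2" for e :: nat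
    by (rule Least_equality) auto
  ultimately have "computable (\<lambda>e. e div 2)" by simp
  then show ?thesis using assms by (rule computable_compose)
qed

lemma decidable_even [decidable_intros]:
  assumes "computable f" shows "decidable (\<lambda>e. even (f e))"
proof -
  have "decidable (\<lambda>e. 2 * (f e div 2) = f e)"
    by (intro decidable_intros computable_intros assms)
  moreover have "2 * (m div 2) = m \<longleftrightarrow> even m" for m :: nat by presburger
  ultimately show ?thesis by simp
qed

lemma computable_power [computable_intros]:
  assumes "computable f" "computable g" shows "computable (\<lambda>e. f e ^ g e)"
proof -
  have f: "computable (\<lambda>p. f (snd (prod_decode (snd (prod_decode p)))))"
    by (rule computable_compose[OF assms(1)]) (intro computable_intros)
  have "computable (\<lambda>e. rec_nat 1 (\<lambda>n r. f e * r) (g e))"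
    by (intro computable_intros assms f)
  moreover have "rec_nat 1 (\<lambda>n r. f e * r) b = f e ^ b" for b e :: nat by (induction b) auto
  ultimately show ?thesis by simp
qed

subsection \<open>Coded lists\<close>

definition code_drop :: "nat \<Rightarrow> nat \<Rightarrow> nat" where
  "code_drop c n = list_encode (drop n (list_decode c))"

text \<open>A nonempty list is coded as the successor of a pair (head, code of the tail), hence the
  subtraction of 1. Past the end \<open>code_drop\<close> is 0 and \<open>code_nth\<close> takes the
  default value 0.\<close>

definition code_nth :: "nat \<Rightarrow> nat \<Rightarrow> nat" where
  "code_nth c n = fst (prod_decode (code_drop c n - 1))"

lemma computable_code_drop [computable_intros]:
  assumes "computable f" "computable g" shows "computable (\<lambda>e. code_drop (f e) (g e))"
proof -
  have tl: "snd (prod_decode (list_encode l - 1)) = list_encode (tl l)" for l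
  proof (cases l)
    case Nil
    have "prod_decode 0 = (0, 0)" using prod_encode_inverse[of "(0, 0)"] by (simp add: prod_encode_def)
    then show ?thesis using Nil by simp
  qed simp
  have f: "computable (\<lambda>p. f (snd (prod_decode (snd (prod_decode p)))))"
    by (rule computable_compose[OF assms(1)]) (intro computable_intros)
  have "computable (\<lambda>e. rec_nat (f e) (\<lambda>n r. snd (prod_decode (r - 1))) (g e))"
    by (intro computable_intros assms f)
  moreover have "rec_nat c (\<lambda>n r. snd (prod_decode (r - 1))) n = code_drop c n" for n c
    by (induction n) (simp_all add: code_drop_def tl[simplified] drop_Suc tl_drop)
  ultimately show ?thesis by simp
qed

lemma computable_code_nth [computable_intros]:
  assumes "computable f" "computable g" shows "computable (\<lambda>e. code_nth (f e) (g e))"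
  unfolding code_nth_def by (intro computable_intros assms)

lemma code_nth_list_encode: "i < length l \<Longrightarrow> code_nth (list_encode l) i = l ! i"
  by (simp add: code_nth_def code_drop_def flip: Cons_nth_drop_Suc)

lemma exists_code: "\<exists>c. \<forall>i<n. code_nth c i = f i"
  by (rule exI[of _ "list_encode (map f [0..<n])"]) (simp add: code_nth_list_encode)

lemma length_le_list_encode: "length l \<le> list_encode l"
proof (induction l)
  case (Cons x l)
  then show ?case using le_prod_encode_2[of "list_encode l" x] by simp
qed simp

text \<open>The length of a list is at most its code, so the code itself can bound the index, and a
  nonzero \<open>code_drop\<close> says that the index is in range. Membership thus costs only a
  bounded quantifier.\<close>

lemma in_set_list_decode:
  "x \<in> set (list_decode c) \<longleftrightarrow> (\<exists>i<c. code_drop c i \<noteq> 0 \<and> code_nth c i = x)"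
proof -
  have drop: "code_drop c i = 0 \<longleftrightarrow> length (list_decode c) \<le> i" for i
    using drop_eq_Nil[of i "list_decode c"]
    unfolding code_drop_def by (cases "drop i (list_decode c)") auto
  have "code_nth c i = list_decode c ! i" if "i < length (list_decode c)" for i
    using code_nth_list_encode[OF that] by simp
  moreover have "length (list_decode c) \<le> c"
    using length_le_list_encode[of "list_decode c"] by simp
  ultimately show ?thesis
    unfolding in_set_conv_nth drop not_le by (metis order.strict_trans2)
qed

lemma computable_list_encode [computable_intros]:
  "computable (\<lambda>e. list_encode [])"
  "computable f \<Longrightarrow> computable (\<lambda>e. list_encode (l e)) \<Longrightarrow> computable (\<lambda>e. list_encode (f e # l e))"
  "computable f \<Longrightarrow> computable (\<lambda>e. list_encode (list_decode (f e)))"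
  by (simp_all add: computable_intros)

section \<open>The arithmetical hierarchy on coded relations\<close>

text \<open>Repeating \<open>\<exists>y. \<not>\<close> yields alternating quantifiers from a single
  clause. Pi_n relations have no notion of their own: they occur as negations.\<close>

primrec sigma :: "nat \<Rightarrow> (nat \<Rightarrow> bool) \<Rightarrow> bool" where
  "sigma 0 P \<longleftrightarrow> decidable P"
| "sigma (Suc n) P \<longleftrightarrow> (\<exists>Q. sigma n Q \<and> (\<forall>x. P x \<longleftrightarrow> (\<exists>y. \<not> Q (prod_encode (y, x)))))"

named_theorems sigma_intros

lemma sigma_SucI:
  assumes "sigma n Q" "\<And>x. P x \<longleftrightarrow> (\<exists>y. \<not> Q (prod_encode (y, x)))"
  shows "sigma (Suc n) P"
  using assms by auto

lemma sigma_compose: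
  "sigma n P \<Longrightarrow> computable f \<Longrightarrow> sigma n (\<lambda>e. P (f e))"
proof (induction n arbitrary: P f)
  case 0
  then show ?case by (simp add: decidable_compose)
next
  case (Suc n)
  then obtain Q where Q: "sigma n Q" "\<And>x. P x \<longleftrightarrow> (\<exists>y. \<not> Q (prod_encode (y, x)))" by auto
  have "sigma n (\<lambda>p. Q (prod_encode (fst (prod_decode p), f (snd (prod_decode p)))))"
    by (rule Suc.IH[OF Q(1)]) (intro computable_intros computable_compose[OF Suc.prems(2)])
  then show ?case by (rule sigma_SucI) (simp add: Q(2))
qed

lemma sigma_decidable: "decidable P \<Longrightarrow> sigma n P"
proof (induction n arbitrary: P)
  case (Suc n)
  have "sigma n (\<lambda>p. \<not> P (snd (prod_decode p)))"
    by (intro Suc.IH decidable_not decidable_compose[OF Suc.prems] computable_intros)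
  then show ?case by (rule sigma_SucI) simp
qed simp

lemma sigma_not:
  assumes "sigma n P" shows "sigma (Suc n) (\<lambda>e. \<not> P e)"
proof -
  have "sigma n (\<lambda>p. P (snd (prod_decode p)))"
    by (intro sigma_compose[OF assms] computable_intros)
  then show ?thesis by (rule sigma_SucI) simp
qed

lemma sigma_mono_Suc: "sigma n P \<Longrightarrow> sigma (Suc n) P"
proof (induction n arbitrary: P)
  case 0
  then show ?case by (intro sigma_decidable) simp
next
  case (Suc n)
  then obtain Q where Q: "sigma n Q" "\<And>x. P x \<longleftrightarrow> (\<exists>y. \<not> Q (prod_encode (y, x)))" by auto
  show ?case by (rule sigma_SucI[OF Suc.IH[OF Q(1)] Q(2)])
qed

lemma sigma_mono: "m \<le> n \<Longrightarrow> sigma m P \<Longrightarrow> sigma n P"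
  by (induction n rule: dec_induct) (auto simp del: sigma.simps intro: sigma_mono_Suc)

text \<open>The negation in front of the matrix exchanges the connectives, so each closure property
  rests on the other one at the level below, and both are proved together.\<close>

lemma sigma_conj_disj:
  "sigma n P \<Longrightarrow> sigma n Q \<Longrightarrow> sigma n (\<lambda>e. P e \<and> Q e) \<and> sigma n (\<lambda>e. P e \<or> Q e)"
proof (induction n arbitrary: P Q)
  case 0
  then show ?case by (auto intro: decidable_intros)
next
  case (Suc n)
  obtain P' where P': "sigma n P'" "\<And>x. P x \<longleftrightarrow> (\<exists>y. \<not> P' (prod_encode (y, x)))"
    using Suc.prems(1) by auto
  obtain Q' where Q': "sigma n Q'" "\<And>x. Q x \<longleftrightarrow> (\<exists>y. \<not> Q' (prod_encode (y, x)))"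
    using Suc.prems(2) by auto
  \<comment> \<open>A conjunction needs independent witnesses, packed as a pair into one variable;
    for the disjunction both sides can share the same witness.\<close>
  have "sigma n (\<lambda>p. P' (prod_encode (fst (prod_decode (fst (prod_decode p))), snd (prod_decode p))))"
    "sigma n (\<lambda>p. Q' (prod_encode (snd (prod_decode (fst (prod_decode p))), snd (prod_decode p))))"
    by (intro sigma_compose[OF P'(1)] sigma_compose[OF Q'(1)] computable_intros)+
  from conjunct2[OF Suc.IH[OF this]] have "sigma (Suc n) (\<lambda>e. P e \<and> Q e)"
    by (rule sigma_SucI) (simp add: P' Q', metis fst_conv prod_encode_inverse snd_conv)
  moreover from conjunct1[OF Suc.IH[OF P'(1) Q'(1)]] have "sigma (Suc n) (\<lambda>e. P e \<or> Q e)"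
    by (rule sigma_SucI) (auto simp: P' Q')
  ultimately show ?case by blast
qed

lemma sigma_conj [sigma_intros]: "sigma n P \<Longrightarrow> sigma n Q \<Longrightarrow> sigma n (\<lambda>e. P e \<and> Q e)"
  and sigma_disj [sigma_intros]: "sigma n P \<Longrightarrow> sigma n Q \<Longrightarrow> sigma n (\<lambda>e. P e \<or> Q e)"
  using sigma_conj_disj by blast+

text \<open>Adjacent existential quantifiers merge into one over a pair. At level 0 there is no
  quantifier to merge with, hence \<open>n \<noteq> 0\<close>.\<close>

lemma sigma_ex [sigma_intros]:
  assumes "sigma n (\<lambda>p. P (fst (prod_decode p)) (snd (prod_decode p)))" "n \<noteq> 0"
  shows "sigma n (\<lambda>e. \<exists>y. P y e)"
proof -
  obtain m where n: "n = Suc m" using assms(2) not0_implies_Suc by blast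
  obtain Q where Q: "sigma m Q" "\<And>x. P (fst (prod_decode x)) (snd (prod_decode x)) \<longleftrightarrow> (\<exists>y. \<not> Q (prod_encode (y, x)))"
    using assms n by auto
  have P: "P y e \<longleftrightarrow> (\<exists>z. \<not> Q (prod_encode (z, prod_encode (y, e))))" for y e
    using Q(2)[of "prod_encode (y, e)"] by simp
  have "sigma m (\<lambda>p. Q (prod_encode (snd (prod_decode (fst (prod_decode p))),
      prod_encode (fst (prod_decode (fst (prod_decode p))), snd (prod_decode p)))))"
    by (intro sigma_compose[OF Q(1)] computable_intros)
  then show ?thesis unfolding n
    by (rule sigma_SucI) (simp add: P, metis fst_conv prod_encode_inverse snd_conv)
qed

lemma one_two_neq_0 [sigma_intros]: "(1::nat) \<noteq> 0" "(2::nat) \<noteq> 0" "Suc n \<noteq> 0"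
  by simp_all

lemma sigma_ex_less [sigma_intros]:
  assumes "sigma n (\<lambda>p. P (fst (prod_decode p)) (snd (prod_decode p)))" "computable b"
  shows "sigma n (\<lambda>e. \<exists>y<b e. P y e)"
proof (cases n)
  case 0
  then show ?thesis using assms by (auto intro: decidable_ex_less)
next
  case (Suc m)
  show ?thesis
    unfolding Suc
    by (intro sigma_intros sigma_decidable decidable_intros computable_intros
        assms(1)[unfolded Suc] computable_compose[OF assms(2)])
qed

text \<open>Collection: the finitely many witnesses for \<open>y < b e\<close> are put into one list
  \<open>c\<close>, which pulls the existential quantifier to the front. Under the negation there
  remains a bounded existential of level \<open>m\<close>, covered by
  \<open>sigma_ex_less\<close>.\<close>

lemma sigma_all_less [sigma_intros]:
  assumes "sigma n (\<lambda>p. P (fst (prod_decode p)) (snd (prod_decode p)))" "computable b"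
  shows "sigma n (\<lambda>e. \<forall>y<b e. P y e)"
proof (cases n)
  case 0
  then show ?thesis using assms by (auto intro: decidable_all_less)
next
  case (Suc m)
  obtain Q where Q: "sigma m Q" "\<And>x. P (fst (prod_decode x)) (snd (prod_decode x)) \<longleftrightarrow> (\<exists>y. \<not> Q (prod_encode (y, x)))"
    using assms Suc by auto
  have P: "P y e \<longleftrightarrow> (\<exists>z. \<not> Q (prod_encode (z, prod_encode (y, e))))" for y e
    using Q(2)[of "prod_encode (y, e)"] by simp
  have eq: "(\<forall>y<b e. P y e) \<longleftrightarrow>
      (\<exists>c. \<not> (\<exists>y<b e. Q (prod_encode (code_nth c y, prod_encode (y, e)))))" for e
  proof
    assume "\<forall>y<b e. P y e"
    then obtain f where f: "\<And>y. y < b e \<Longrightarrow> \<not> Q (prod_encode (f y, prod_encode (y, e)))"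
      unfolding P by metis
    obtain c where "\<forall>y<b e. code_nth c y = f y" using exists_code by blast
    with f show "\<exists>c. \<not> (\<exists>y<b e. Q (prod_encode (code_nth c y, prod_encode (y, e))))"
      by (intro exI[of _ c]) auto
  qed (auto simp: P)
  have "sigma m (\<lambda>p. \<exists>y<b (snd (prod_decode p)).
      Q (prod_encode (code_nth (fst (prod_decode p)) y, prod_encode (y, snd (prod_decode p)))))"
    by (intro sigma_ex_less sigma_compose[OF Q(1)] computable_intros computable_compose[OF assms(2)])
  then show ?thesis unfolding Suc
    by (rule sigma_SucI) (simp only: eq prod_encode_inverse fst_conv snd_conv)
qed

lemma sigma_ex_list [sigma_intros]:
  assumes "sigma n (\<lambda>p. P (list_decode (fst (prod_decode p))) (snd (prod_decode p)))" "n \<noteq> 0"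
  shows "sigma n (\<lambda>e. \<exists>l. P l e)"
proof -
  have "sigma n (\<lambda>e. \<exists>c. P (list_decode c) e)"
    by (intro sigma_intros assms)
  moreover have "(\<exists>c. P (list_decode c) e) \<longleftrightarrow> (\<exists>l. P l e)" for e
    by (metis list_encode_inverse)
  ultimately show ?thesis by simp
qed

lemma sigma_all_set [sigma_intros]:
  assumes "sigma n (\<lambda>p. P (fst (prod_decode p)) (snd (prod_decode p)))"
    and "computable (\<lambda>e. list_encode (l e))"
  shows "sigma n (\<lambda>e. \<forall>x\<in>set (l e). P x e)"
proof -
  have l: "computable (\<lambda>p. list_encode (l (snd (prod_decode p))))"
    by (intro computable_compose[OF assms(2)] computable_intros)
  have "sigma n (\<lambda>p. P (code_nth (list_encode (l (snd (prod_decode p)))) (fst (prod_decode p))) (snd (prod_decode p)))"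
    using sigma_compose[OF assms(1), of "\<lambda>p. prod_encode (code_nth (list_encode (l (snd (prod_decode p)))) (fst (prod_decode p)), snd (prod_decode p))"]
    by (simp add: computable_intros l)
  note this [sigma_intros]
  have "sigma n (\<lambda>e. \<forall>i<list_encode (l e). code_drop (list_encode (l e)) i = 0
      \<or> P (code_nth (list_encode (l e)) i) e)"
    by (intro sigma_intros sigma_decidable decidable_intros computable_intros assms(2) l)
  moreover have "(\<forall>x\<in>set (list_decode c). Q x) \<longleftrightarrow> (\<forall>i<c. code_drop c i = 0 \<or> Q (code_nth c i))" for Q c
    unfolding Ball_def in_set_list_decode by auto
  from this[of "list_encode (l e)" for e] have "(\<forall>x\<in>set (l e). P x e) \<longleftrightarrow>
      (\<forall>i<list_encode (l e). code_drop (list_encode (l e)) i = 0 \<or> P (code_nth (list_encode (l e)) i) e)" for e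
    by (simp only: list_encode_inverse)
  ultimately show ?thesis by (simp only:)
qed

text \<open>A chain of \<open>k\<close> steps is coded as a list of \<open>k + 1\<close> numbers, so
  iteration costs one existential and one bounded quantifier. Applied to an enumeration of preimage
  balls, this treats the iterates of a map uniformly in \<open>k\<close>.\<close>

lemma sigma_relpow [sigma_intros]:
  assumes "sigma n (\<lambda>p. (fst (prod_decode p), snd (prod_decode p)) \<in> R)" "n \<noteq> 0"
    and "computable k" "computable a" "computable b"
  shows "sigma n (\<lambda>e. (a e, b e) \<in> R ^^ k e)"
proof -
  have R: "sigma n (\<lambda>e. (f e, g e) \<in> R)" if "computable f" "computable g" for f g
    using sigma_compose[OF assms(1) computable_basic(7)[OF that]] by simp
  have "(a e, b e) \<in> R ^^ k e \<longleftrightarrow> (\<exists>c. code_nth c 0 = a e \<and> code_nth c (k e) = b e \<and>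
      (\<forall>i<k e. (code_nth c i, code_nth c (Suc i)) \<in> R))" for e
  proof
    assume "(a e, b e) \<in> R ^^ k e"
    then obtain f where f: "f 0 = a e" "f (k e) = b e" "\<forall>i<k e. (f i, f (Suc i)) \<in> R"
      unfolding relpow_fun_conv by blast
    obtain c where "\<forall>i<Suc (k e). code_nth c i = f i" using exists_code by blast
    with f show "\<exists>c. code_nth c 0 = a e \<and> code_nth c (k e) = b e \<and>
      (\<forall>i<k e. (code_nth c i, code_nth c (Suc i)) \<in> R)"
      by (intro exI[of _ c]) auto
  next
    assume "\<exists>c. code_nth c 0 = a e \<and> code_nth c (k e) = b e \<and>
      (\<forall>i<k e. (code_nth c i, code_nth c (Suc i)) \<in> R)"
    then show "(a e, b e) \<in> R ^^ k e" unfolding relpow_fun_conv by blast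
  qed
  moreover have "sigma n (\<lambda>e. \<exists>c. code_nth c 0 = a e \<and> code_nth c (k e) = b e \<and>
      (\<forall>i<k e. (code_nth c i, code_nth c (Suc i)) \<in> R))"
    by (intro sigma_intros sigma_decidable decidable_intros computable_intros R assms(2)
        assms(3-5)[THEN computable_compose])
  ultimately show ?thesis by simp
qed

subsection \<open>Comparison with relations on lists\<close>

text \<open>The parameter \<open>k\<close> stands for length \<open>k + 1\<close>: the last entry
  stays unpaired. At a fixed length coding and decoding are then mutually inverse, and every number
  is a code.\<close>

primrec tuple_decode :: "nat \<Rightarrow> nat \<Rightarrow> nat list" where
  "tuple_decode 0 e = [e]"
| "tuple_decode (Suc k) e = fst (prod_decode e) # tuple_decode k (snd (prod_decode e))"

fun tuple_encode :: "nat list \<Rightarrow> nat" where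
  "tuple_encode [] = 0"
| "tuple_encode [x] = x"
| "tuple_encode (x # y # xs) = prod_encode (x, tuple_encode (y # xs))"

lemma length_tuple_decode [simp]: "length (tuple_decode k e) = Suc k"
  by (induction k arbitrary: e) auto

lemma tuple_decode_encode: "length xs = Suc k \<Longrightarrow> tuple_decode k (tuple_encode xs) = xs"
  by (induction k arbitrary: xs) (auto simp: length_Suc_conv)

lemma tuple_encode_decode: "tuple_encode (tuple_decode k e) = e"
proof (induction k arbitrary: e)
  case (Suc k)
  obtain y ys where y: "tuple_decode k (snd (prod_decode e)) = y # ys"
    by (metis length_tuple_decode length_Suc_conv)
  show ?case using Suc.IH[of "snd (prod_decode e)"] by (simp add: y)
qed simp

lemma computable_on_tuple_encode: "computable_on (Suc k) tuple_encode"
proof (induction k)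
  case 0
  show ?case
    by (rule computable_on_cong[OF computable_on_nth[of 0]]) (auto simp: length_Suc_conv)
next
  case (Suc k)
  have "computable_on (Suc (Suc k))
     (\<lambda>xs. tuple_encode (map (\<lambda>g. g xs) (map (\<lambda>i xs. xs ! Suc i) [0..<Suc k])))"
    by (rule computable_on_compose) (use Suc in \<open>auto intro: computable_on_nth\<close>)
  moreover have "map (\<lambda>g. g xs) (map (\<lambda>i xs. xs ! Suc i) [0..<Suc k]) = tl xs"
    if "length xs = Suc (Suc k)" for xs :: "nat list"
    using that by (intro nth_equalityI) (auto simp: nth_tl simp del: upt_Suc)
  ultimately have "computable_on (Suc (Suc k)) (\<lambda>xs. tuple_encode (tl xs))"
    by (auto intro: computable_on_cong simp del: upt_Suc)
  from computable_on_prod_encode[OF computable_on_nth[of 0] this]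
  show ?case by (rule computable_on_cong) (auto simp: length_Suc_conv)
qed

lemma computable_tuple_decode_nth: "i \<le> k \<Longrightarrow> computable (\<lambda>e. tuple_decode k e ! i)"
proof (induction k arbitrary: i)
  case 0
  then show ?case by (simp add: computable_intros)
next
  case (Suc k)
  show ?case
  proof (cases i)
    case 0
    then show ?thesis by (simp add: computable_intros)
  next
    case (Suc j)
    have "computable (\<lambda>e. tuple_decode k (snd (prod_decode e)) ! j)"
      by (intro computable_compose[OF Suc.IH] computable_intros) (use Suc Suc.prems in auto)
    then show ?thesis using Suc by simp
  qed
qed

lemma decidable_rel_iff_decidable: "decidable_rel (Suc k) R \<longleftrightarrow> decidable (\<lambda>e. R (tuple_decode k e))"
proof
  assume "decidable_rel (Suc k) R"
  then have R: "computable_on (Suc k) (\<lambda>xs. if R xs then 1 else 0)"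
    unfolding decidable_rel_def computable_on_def .
  let ?gs = "map (\<lambda>i xs. tuple_decode k (xs ! 0) ! i) [0..<Suc k]"
  have "computable_on 1 (\<lambda>xs. (\<lambda>xs. if R xs then 1 else 0) (map (\<lambda>g. g xs) ?gs))"
  proof (rule computable_on_compose)
    show "computable_on (length ?gs) (\<lambda>xs. if R xs then 1 else 0)" using R by simp
    fix g assume "g \<in> set ?gs"
    then obtain i where "i \<in> set [0..<Suc k]" "g = (\<lambda>xs. tuple_decode k (xs ! 0) ! i)"
      unfolding set_map image_iff by blast
    moreover from this have "i \<le> k" by auto
    ultimately show "computable_on 1 g"
      using computable_tuple_decode_nth unfolding computable_def by blast
  qed
  moreover have "map (\<lambda>g. g xs) ?gs = tuple_decode k (xs ! 0)" for xs
    by (intro nth_equalityI) (auto simp del: upt_Suc)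
  ultimately show "decidable (\<lambda>e. R (tuple_decode k e))"
    unfolding decidable_def computable_def by (simp del: upt_Suc)
next
  assume "decidable (\<lambda>e. R (tuple_decode k e))"
  then have "computable_on (Suc k) (\<lambda>xs. if R (tuple_decode k (tuple_encode xs)) then 1 else 0)"
    unfolding decidable_def using computable_on_computable computable_on_tuple_encode by blast
  then have "computable_on (Suc k) (\<lambda>xs. if R xs then 1 else 0)"
    by (rule computable_on_cong) (simp add: tuple_decode_encode)
  then show "decidable_rel (Suc k) R"
    unfolding decidable_rel_def computable_on_def .
qed

text \<open>The newly quantified variable is the head of the list on one side and the first
  component of the pair on the other, so the two hierarchies match clause by clause.\<close>

lemma Sigma_rel_iff_sigma: "Sigma_rel n (Suc k) R \<longleftrightarrow> sigma n (\<lambda>e. R (tuple_decode k e))"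
proof (induction n arbitrary: k R)
  case 0
  then show ?case by (simp add: decidable_rel_iff_decidable)
next
  case (Suc n)
  show ?case
  proof
    assume "Sigma_rel (Suc n) (Suc k) R"
    then obtain S where S: "Sigma_rel n (Suc (Suc k)) S"
      "\<And>xs. length xs = Suc k \<Longrightarrow> R xs \<longleftrightarrow> (\<exists>y. \<not> S (y # xs))" by auto
    have "sigma n (\<lambda>e. S (tuple_decode (Suc k) e))" using S(1) Suc.IH by blast
    then show "sigma (Suc n) (\<lambda>e. R (tuple_decode k e))"
      by (rule sigma_SucI) (simp add: S(2))
  next
    assume "sigma (Suc n) (\<lambda>e. R (tuple_decode k e))"
    then obtain Q where Q: "sigma n Q"
      "\<And>e. R (tuple_decode k e) \<longleftrightarrow> (\<exists>y. \<not> Q (prod_encode (y, e)))" by auto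
    have "Sigma_rel n (Suc (Suc k)) (\<lambda>xs. Q (tuple_encode xs))"
      using Q(1) by (simp add: Suc.IH tuple_encode_decode del: tuple_decode.simps)
    moreover have "R xs \<longleftrightarrow> (\<exists>y. \<not> Q (tuple_encode (y # xs)))" if "length xs = Suc k" for xs
      using Q(2)[of "tuple_encode xs"] that by (auto simp: tuple_decode_encode length_Suc_conv)
    ultimately show "Sigma_rel (Suc n) (Suc k) R" by auto
  qed
qed

lemma Sigma_set_iff_sigma: "Sigma_set n A \<longleftrightarrow> sigma n (\<lambda>x. x \<in> A)"
  unfolding Sigma_set_def using Sigma_rel_iff_sigma[of n 0] by simp

subsection \<open>Graphs of programs\<close>

lemma evaluates_Comp_iff:
  "evaluates (Comp f gs) xs z \<longleftrightarrow>
     (\<exists>ys. list_all2 (\<lambda>g y. evaluates g xs y) gs ys \<and> evaluates f ys z)"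
  by (auto elim: evaluates_CompE intro: evaluates.Comp)

text \<open>\<open>c\<close> codes the table of values at \<open>0, ..., n\<close>. A terminating
  recursion becomes a statement about one number, with only a bounded universal quantifier
  inside.\<close>

lemma evaluates_Prec_iff:
  "evaluates (Prec f g) l y \<longleftrightarrow>
     (\<exists>n xs c. l = n # xs \<and> evaluates f xs (code_nth c 0) \<and> code_nth c n = y \<and>
        (\<forall>i<n. evaluates g (i # code_nth c i # xs) (code_nth c (Suc i))))"
proof
  have *: "\<exists>h. evaluates f xs (h 0) \<and> h n = y \<and> (\<forall>i<n. evaluates g (i # h i # xs) (h (Suc i)))"
    if "evaluates (Prec f g) (n # xs) y" for n xs y
    using that
  proof (induction n arbitrary: y)
    case 0
    then have "evaluates f xs y" by (rule evaluates_Prec_0E)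
    then show ?case by auto
  next
    case (Suc n)
    from Suc.prems obtain r where r: "evaluates (Prec f g) (n # xs) r" "evaluates g (n # r # xs) y"
      by (rule evaluates_Prec_SucE)
    from Suc.IH[OF r(1)] obtain h where
      h: "evaluates f xs (h 0)" "h n = r" "\<forall>i<n. evaluates g (i # h i # xs) (h (Suc i))" by blast
    show ?case
      by (rule exI[of _ "h(Suc n := y)"]) (use h r in \<open>auto simp: less_Suc_eq\<close>)
  qed
  assume e: "evaluates (Prec f g) l y"
  then obtain n xs where l: "l = n # xs" by (auto elim: evaluates_PrecE)
  with * e obtain h where h: "evaluates f xs (h 0)" "h n = y" "\<forall>i<n. evaluates g (i # h i # xs) (h (Suc i))"
    by blast
  obtain c where "\<forall>i<Suc n. code_nth c i = h i" using exists_code by blast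
  with h l show "\<exists>n xs c. l = n # xs \<and> evaluates f xs (code_nth c 0) \<and> code_nth c n = y \<and>
        (\<forall>i<n. evaluates g (i # code_nth c i # xs) (code_nth c (Suc i)))"
    by (intro exI[of _ n] exI[of _ xs] exI[of _ c]) auto
next
  assume "\<exists>n xs c. l = n # xs \<and> evaluates f xs (code_nth c 0) \<and> code_nth c n = y \<and>
        (\<forall>i<n. evaluates g (i # code_nth c i # xs) (code_nth c (Suc i)))"
  then obtain n xs c where l: "l = n # xs" "code_nth c n = y" and f: "evaluates f xs (code_nth c 0)"
    and g: "\<And>i. i < n \<Longrightarrow> evaluates g (i # code_nth c i # xs) (code_nth c (Suc i))"
    by blast
  have "evaluates (Prec f g) (i # xs) (code_nth c i)" if "i \<le> n" for i
    using that
    by (induction i) (auto intro: evaluates.Prec_0[OF f] evaluates.Prec_Suc[OF _ g])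
  then show "evaluates (Prec f g) l y" using l by auto
qed

lemma evaluates_Mn_iff:
  "evaluates (Mn f) l n \<longleftrightarrow> evaluates f (n # l) 0 \<and> (\<forall>m<n. \<exists>y. 0 < y \<and> evaluates f (m # l) y)"
  by (auto elim!: evaluates_MnE intro!: evaluates.Mn)

lemma evaluates_Zero_iff: "evaluates Zero xs y \<longleftrightarrow> y = 0"
  by (auto elim: evaluates_ZeroE intro: evaluates.Zero)

lemma evaluates_Succ_iff: "evaluates Succ xs y \<longleftrightarrow> (\<exists>x. xs = [x] \<and> y = Suc x)"
  by (auto elim: evaluates_SuccE intro: evaluates.Succ)

lemma evaluates_Proj_iff:
  "evaluates (Proj i) xs y \<longleftrightarrow> code_drop (list_encode xs) i \<noteq> 0 \<and> code_nth (list_encode xs) i = y"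
proof -
  have "code_drop (list_encode xs) i = 0 \<longleftrightarrow> length xs \<le> i"
    using drop_eq_Nil[of i xs] unfolding code_drop_def by (cases "drop i xs") auto
  then show ?thesis
    by (auto simp: code_nth_list_encode not_le elim: evaluates_ProjE intro: evaluates.Proj)
qed

lemma list_decode_eq_iff: "list_decode c = l \<longleftrightarrow> c = list_encode l"
  by auto

lemma sigma_evaluates_compose:
  assumes "sigma n (\<lambda>e. evaluates p (list_decode (fst (prod_decode e))) (snd (prod_decode e)))"
    and "computable (\<lambda>e. list_encode (l e))" "computable y"
  shows "sigma n (\<lambda>e. evaluates p (l e) (y e))"
  using sigma_compose[OF assms(1) computable_basic(7)[OF assms(2,3)]] by simp

lemma sigma_list_all2_evaluates:
  assumes "\<And>g. g \<in> set gs \<Longrightarrow>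
    sigma 1 (\<lambda>e. evaluates g (list_decode (fst (prod_decode e))) (snd (prod_decode e)))"
  shows "sigma 1 (\<lambda>e. list_all2 (\<lambda>g y. evaluates g (list_decode (fst (prod_decode e))) y) gs
    (list_decode (snd (prod_decode e))))"
  using assms
proof (induction gs)
  case Nil
  have "sigma 1 (\<lambda>e. snd (prod_decode e) = list_encode [])"
    by (intro sigma_decidable decidable_intros computable_intros)
  then show ?case by (simp add: list_decode_eq_iff)
next
  case (Cons g gs)
  have *: "list_all2 P (g # gs) (list_decode c) \<longleftrightarrow>
     (\<exists>y d. c = list_encode (y # list_decode d) \<and> P g y \<and> list_all2 P gs (list_decode d))" for P c
    by (auto simp: list_all2_Cons1 list_decode_eq_iff simp del: list_encode.simps)
      (metis list_encode_inverse)
  have gs: "sigma 1 (\<lambda>e. list_all2 (\<lambda>g y. evaluates g (list_decode (a e)) y) gs (list_decode (b e)))"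
    if "computable a" "computable b" for a b
    using sigma_compose[OF Cons.IH computable_basic(7)[OF that]] Cons.prems by simp
  show ?case
    unfolding *
    by (intro sigma_intros sigma_decidable decidable_intros gs computable_intros
        sigma_evaluates_compose[OF Cons.prems]) simp
qed

text \<open>Every construct costs only existential and bounded quantifiers. Unbounded search stays
  Sigma_1 because its universal quantifier ranges below the result.\<close>

lemma sigma_evaluates_graph:
  "sigma 1 (\<lambda>e. evaluates p (list_decode (fst (prod_decode e))) (snd (prod_decode e)))"
proof (induction p)
  case Zero
  show ?case unfolding evaluates_Zero_iff
    by (intro sigma_decidable decidable_intros computable_intros)
next
  case Succ
  show ?case unfolding evaluates_Succ_iff list_decode_eq_iff
    by (intro sigma_intros sigma_decidable decidable_intros computable_intros)
next
  case (Proj i)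
  show ?case unfolding evaluates_Proj_iff
    by (intro sigma_intros sigma_decidable decidable_intros computable_intros)
next
  case (Comp f gs)
  have gs: "sigma 1 (\<lambda>e. list_all2 (\<lambda>g y. evaluates g (list_decode (a e)) y) gs (list_decode (b e)))"
    if "computable a" "computable b" for a b
    using sigma_compose[OF sigma_list_all2_evaluates computable_basic(7)[OF that]] Comp by simp
  show ?case unfolding evaluates_Comp_iff
    by (intro sigma_intros gs sigma_evaluates_compose[OF Comp.IH(1)] computable_intros)
next
  case (Prec f g)
  show ?case unfolding evaluates_Prec_iff list_decode_eq_iff
    by (intro sigma_intros sigma_evaluates_compose[OF Prec.IH(1)] sigma_evaluates_compose[OF Prec.IH(2)]
        sigma_decidable decidable_intros computable_intros)
next
  case (Mn f)
  show ?case unfolding evaluates_Mn_iff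
    by (intro sigma_intros sigma_evaluates_compose[OF Mn.IH] sigma_decidable decidable_intros computable_intros)
qed

lemmas sigma_evaluates [sigma_intros] = sigma_evaluates_compose[OF sigma_evaluates_graph]

lemma sigma_halts [sigma_intros]:
  assumes "computable (\<lambda>e. list_encode (l e))"
  shows "sigma 1 (\<lambda>e. halts p (l e))"
  unfolding halts_def
  by (intro sigma_intros computable_intros computable_compose[OF assms])

lemma sigma_enumerated [sigma_intros]:
  assumes "computable f" "computable g" shows "sigma 1 (\<lambda>e. f e \<in> enumerated p (g e))"
  unfolding enumerated_def mem_Collect_eq
  by (intro sigma_intros computable_intros assms[THEN computable_compose])

subsection \<open>Computable rational-valued functions\<close>

text \<open>A difference of natural numbers over a positive one: signs and comparisons reduce to
  arithmetic on natural numbers.\<close>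

definition computable_rat :: "(nat \<Rightarrow> real) \<Rightarrow> bool" where
  "computable_rat f \<longleftrightarrow> (\<exists>u v w. computable u \<and> computable v \<and> computable w \<and>
     (\<forall>e. w e > 0 \<and> f e = (real (u e) - real (v e)) / real (w e)))"

lemma computable_ratI:
  assumes "computable u" "computable v" "computable w"
    and "\<And>e. w e > 0" "\<And>e. f e = (real (u e) - real (v e)) / real (w e)"
  shows "computable_rat f"
  using assms unfolding computable_rat_def by blast

named_theorems computable_rat_intros

lemma computable_rat_quotient:
  assumes "computable f" "computable g" "\<And>e. g e > 0"
  shows "computable_rat (\<lambda>e. real (f e) / real (g e))"
  by (rule computable_ratI[of f "\<lambda>_. 0" g]) (use assms in \<open>auto intro: computable_intros\<close>)

lemma computable_rat_radius [computable_rat_intros]: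
  assumes "computable f" shows "computable_rat (\<lambda>e. radius (f e))"
proof -
  have r: "radius i = real (Suc (fst (prod_decode (snd (prod_decode i)))))
      / real (Suc (snd (prod_decode (snd (prod_decode i)))))" for i
    by (simp add: radius_def case_prod_beta)
  show ?thesis
    unfolding r by (intro computable_rat_quotient computable_intros assms) simp
qed

lemma computable_rat_power [computable_rat_intros]:
  assumes "computable f" shows "computable_rat (\<lambda>e. 1 / 2 ^ f e)"
proof -
  have "computable_rat (\<lambda>e. real 1 / real (2 ^ f e))"
    by (intro computable_rat_quotient computable_intros assms) simp
  then show ?thesis by simp
qed

lemma computable_rat_add [computable_rat_intros]:
  assumes "computable_rat f" "computable_rat g"
  shows "computable_rat (\<lambda>e. f e + g e)"
proof -
  obtain u v w where f: "computable u" "computable v" "computable w"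
    "\<And>e. w e > 0" "\<And>e. f e = (real (u e) - real (v e)) / real (w e)"
    using assms(1) unfolding computable_rat_def by blast
  obtain u' v' w' where g: "computable u'" "computable v'" "computable w'"
    "\<And>e. w' e > 0" "\<And>e. g e = (real (u' e) - real (v' e)) / real (w' e)"
    using assms(2) unfolding computable_rat_def by blast
  have *: "w e \<noteq> 0" "w' e \<noteq> 0" for e using f(4)[of e] g(4)[of e] by auto
  show ?thesis
    by (rule computable_ratI[of "\<lambda>e. u e * w' e + u' e * w e" "\<lambda>e. v e * w' e + v' e * w e" "\<lambda>e. w e * w' e"])
      (use f(1-4) g(1-4) * in \<open>auto intro: computable_intros simp: f(5) g(5) field_simps\<close>)
qed

lemma computable_rat_diff [computable_rat_intros]:
  assumes "computable_rat f" "computable_rat g"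
  shows "computable_rat (\<lambda>e. f e - g e)"
proof -
  obtain u v w where g: "computable u" "computable v" "computable w"
    "\<And>e. w e > 0" "\<And>e. g e = (real (u e) - real (v e)) / real (w e)"
    using assms(2) unfolding computable_rat_def by blast
  have "computable_rat (\<lambda>e. - g e)"
    by (rule computable_ratI[of v u w]) (use g in \<open>auto simp: minus_divide_left\<close>)
  from computable_rat_add[OF assms(1) this] show ?thesis by simp
qed

lemma decidable_rat_less [decidable_intros]:
  assumes "computable_rat f" "computable_rat g"
  shows "decidable (\<lambda>e. f e < g e)"
proof -
  obtain u v w where f: "computable u" "computable v" "computable w"
    "\<And>e. w e > 0" "\<And>e. f e = (real (u e) - real (v e)) / real (w e)"
    using assms(1) unfolding computable_rat_def by blast
  obtain u' v' w' where g: "computable u'" "computable v'" "computable w'"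
    "\<And>e. w' e > 0" "\<And>e. g e = (real (u' e) - real (v' e)) / real (w' e)"
    using assms(2) unfolding computable_rat_def by blast
  have "f e < g e \<longleftrightarrow> real (u e * w' e + v' e * w e) < real (u' e * w e + v e * w' e)" for e
    unfolding f(5) g(5) using f(4)[of e] g(4)[of e] by (simp add: field_simps)
  then have "f e < g e \<longleftrightarrow> u e * w' e + v' e * w e < u' e * w e + v e * w' e" for e
    by (simp only: of_nat_less_iff)
  then show ?thesis
    by (simp only:) (intro decidable_intros computable_intros f g)
qed

lemma computable_rat_rat_of_code [computable_rat_intros]:
  assumes "computable f" shows "computable_rat (\<lambda>e. rat_of_code (f e))"
proof -
  define pos where "pos n = (if even n then n div 2 else 0)" for n :: nat
  define neg where "neg n = (if even n then 0 else Suc (n div 2))" for n :: nat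
  define num den where "num c = fst (prod_decode c)" and "den c = snd (prod_decode c)" for c
  \<comment> \<open>A coded denominator may be negative or zero. Its sign is moved to the numerator
    through \<open>u\<close> and \<open>v\<close>, its absolute value is \<open>w\<close>, and a
    zero denominator stands for the value 0.\<close>
  define u where "u c = (if pos (den c) = 0 then neg (num c) else pos (num c))" for c
  define v where "v c = (if pos (den c) = 0 then pos (num c) else neg (num c))" for c
  define w where "w c = pos (den c) + neg (den c)" for c
  have int: "int_decode n = int (pos n) - int (neg n)" for n
    by (auto simp: int_decode_def sum_decode_def pos_def neg_def)
  have pn: "pos n = 0 \<or> neg n = 0" for n by (simp add: pos_def neg_def)
  have r: "rat_of_code c = (real (if w c = 0 then 0 else u c) - real (if w c = 0 then 0 else v c))
      / real (if w c = 0 then 1 else w c)" for c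
  proof -
    have "rat_of_code c = of_int (int_decode (num c)) / of_int (int_decode (den c))"
      by (simp add: rat_of_code_def nat_to_rat_surj_def case_prod_beta num_def den_def Fract_of_int_quotient of_rat_divide)
    then show ?thesis
      using pn[of "den c"] by (auto simp: int u_def v_def w_def field_simps minus_divide_left)
  qed
  have c: "computable (\<lambda>c. if w c = 0 then 0 else u c)" "computable (\<lambda>c. if w c = 0 then 0 else v c)"
    "computable (\<lambda>c. if w c = 0 then 1 else w c)"
    unfolding u_def v_def w_def pos_def neg_def num_def den_def
    by (intro computable_intros decidable_intros)+
  show ?thesis
    by (rule computable_ratI[OF c[THEN computable_compose, OF assms]]) (auto simp: r)
qed

declare sigma.simps [simp del]

lemma sigma_of_sigma_1: "sigma 1 P \<Longrightarrow> n \<noteq> 0 \<Longrightarrow> sigma n P"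
  by (rule sigma_mono) auto

section \<open>Effective topology\<close>

lemma computable_centre [computable_intros]:
  "computable f \<Longrightarrow> computable (\<lambda>e. centre (f e))"
  unfolding centre_def by (intro computable_intros)

lemma computable_rat_compose:
  assumes "computable_rat q" "computable f" shows "computable_rat (\<lambda>e. q (f e))"
proof -
  obtain u v w where "computable u" "computable v" "computable w"
    "\<And>e. w e > 0" "\<And>e. q e = (real (u e) - real (v e)) / real (w e)"
    using assms(1) unfolding computable_rat_def by blast
  then show ?thesis
    using assms(2)
    by (intro computable_ratI[of "\<lambda>e. u (f e)" "\<lambda>e. v (f e)" "\<lambda>e. w (f e)"]) (auto intro: computable_compose)
qed

lemma computable_rat_half [computable_rat_intros]: "computable_rat (\<lambda>e. 1 / 2)"
  using computable_rat_power[of "\<lambda>_. 1"] by (simp add: computable_intros)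

lemma radius_pos: "radius i > 0"
  by (simp add: radius_def case_prod_beta)

lemma open_ideal_ball: "open (ideal_ball s i)"
  by (simp add: ideal_ball_def)

lemma closed_ideal_cball: "closed (ideal_cball s i)"
  by (simp add: ideal_cball_def)

lemma ideal_ball_subset_cball: "ideal_ball s i \<subseteq> ideal_cball s i"
  by (auto simp: ideal_ball_def ideal_cball_def)

lemma ideal_cball_subset_ball:
  "centre i = centre j \<Longrightarrow> radius i < radius j \<Longrightarrow> ideal_cball s i \<subseteq> ideal_ball s j"
  by (auto simp: ideal_ball_def ideal_cball_def)

lemma exists_concentric:
  assumes "0 \<le> a" "a < b"
  shows "\<exists>j. centre j = centre i \<and> a < radius j \<and> radius j < b"
proof -
  obtain r where r: "r \<in> \<rat>" "a < r" "r < b" using Rats_dense_in_real[OF assms(2)] by blast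
  obtain m n :: nat where mn: "n \<noteq> 0" "\<bar>r\<bar> = real m / real n"
    using Rats_abs_nat_div_natE[OF r(1)] by metis
  have "m \<noteq> 0" using mn r assms by (intro notI) simp
  then obtain m' n' where "m = Suc m'" "n = Suc n'" using mn(1) not0_implies_Suc by metis
  then have "radius (prod_encode (centre i, prod_encode (m', n'))) = r"
    using mn(2) r(2) assms(1) by (simp add: radius_def)
  then show ?thesis
    using r by (intro exI[of _ "prod_encode (centre i, prod_encode (m', n'))"]) (simp add: centre_def)
qed

text \<open>A strict inequality about the centres, hence semi-decidable. It is sufficient for the
  closed balls to be disjoint, but disjoint balls need not satisfy it.\<close>

definition far :: "(nat \<Rightarrow> 'a::metric_space) \<Rightarrow> nat \<Rightarrow> nat \<Rightarrow> bool" where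
  "far s i j \<longleftrightarrow> radius i + radius j < dist (s (centre i)) (s (centre j))"

definition balls :: "(nat \<Rightarrow> 'a::metric_space) \<Rightarrow> (nat \<Rightarrow> bool) \<Rightarrow> 'a set" where
  "balls s E = (\<Union>m\<in>{m. E m}. ideal_ball s m)"

lemma mem_balls: "x \<in> balls s E \<longleftrightarrow> (\<exists>m. E m \<and> x \<in> ideal_ball s m)"
  by (auto simp: balls_def)

lemma open_balls: "open (balls s E)"
  by (auto simp: balls_def open_ideal_ball)

locale recursively_compact_space =
  fixes s :: "nat \<Rightarrow> 'a::metric_space"
  assumes computable_metric: "computable_metric_space s"
    and recursively_compact_UNIV: "recursively_compact s (UNIV :: 'a set)"
begin

lemma compact_UNIV: "compact (UNIV :: 'a set)"
  using recursively_compact_UNIV unfolding recursively_compact_def by blast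

lemma closed_imp_compact: "closed K \<Longrightarrow> compact (K :: 'a set)"
  using compact_UNIV closed_Int_compact by fastforce

lemma exists_ideal_point: "open U \<Longrightarrow> U \<noteq> {} \<Longrightarrow> \<exists>l. s l \<in> U"
  using computable_metric open_Int_closure_eq_empty[of U "range s"]
  unfolding computable_metric_space_def by auto

lemma exists_small_ideal_ball:
  assumes "\<epsilon> > 0" shows "\<exists>m. x \<in> ideal_ball s m \<and> radius m < \<epsilon>"
proof -
  obtain b where b: "1 / real (Suc b) < \<epsilon>"
    using assms nat_approx_posE by metis
  obtain i where i: "s i \<in> ball x (1 / real (Suc b))"
    using exists_ideal_point[of "ball x (1 / real (Suc b))"] by fastforce
  show ?thesis
    by (rule exI[of _ "prod_encode (i, prod_encode (0, b))"])
      (use b i in \<open>auto simp: ideal_ball_def radius_def centre_def dist_commute\<close>)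
qed

lemma open_contains_ideal_cball:
  assumes "open U" "x \<in> U"
  shows "\<exists>m. x \<in> ideal_ball s m \<and> ideal_cball s m \<subseteq> U"
proof -
  obtain \<epsilon> where e: "\<epsilon> > 0" "ball x \<epsilon> \<subseteq> U" using assms openE by blast
  obtain m where m: "x \<in> ideal_ball s m" "radius m < \<epsilon> / 2"
    using exists_small_ideal_ball[of "\<epsilon> / 2"] e(1) by auto
  have "ideal_cball s m \<subseteq> ball x \<epsilon>"
  proof
    fix z assume "z \<in> ideal_cball s m"
    then show "z \<in> ball x \<epsilon>"
      using m dist_triangle[of x z "s (centre m)"]
      by (simp add: ideal_ball_def ideal_cball_def dist_commute)
  qed
  with m e show ?thesis by blast
qed

text \<open>A point outside the closed ball leaves a positive gap. An ideal ball around it with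
  radius below half the gap is far: one half absorbs the radius, the other the distance from the
  point to the new centre. The complement is thereby an effective open set.\<close>

lemma Compl_ideal_cball: "- ideal_cball s i = balls s (\<lambda>m. far s m i)"
proof (intro set_eqI iffI)
  fix x assume "x \<in> - ideal_cball s i"
  then have "0 < (dist (s (centre i)) x - radius i) / 2" by (simp add: ideal_cball_def)
  then obtain m where m: "x \<in> ideal_ball s m" "radius m < (dist (s (centre i)) x - radius i) / 2"
    using exists_small_ideal_ball by blast
  then have "far s m i"
    using dist_triangle[of "s (centre i)" x "s (centre m)"]
    by (simp add: far_def ideal_ball_def dist_commute field_simps)
  with m show "x \<in> balls s (\<lambda>m. far s m i)" by (auto simp: mem_balls)
next
  fix x assume "x \<in> balls s (\<lambda>m. far s m i)"
  then obtain m where "far s m i" "x \<in> ideal_ball s m" by (auto simp: mem_balls)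
  then show "x \<in> - ideal_cball s i"
    using dist_triangle[of "s (centre m)" "s (centre i)" x]
    by (simp add: far_def ideal_ball_def ideal_cball_def dist_commute)
qed

lemma compact_subset_balls:
  assumes "compact K" "K \<subseteq> balls s E"
  shows "\<exists>l. (\<forall>m\<in>set l. E m) \<and> K \<subseteq> (\<Union>m\<in>set l. ideal_ball s m)"
proof -
  from assms(1) obtain C where C: "C \<subseteq> {m. E m}" "finite C" "K \<subseteq> (\<Union>m\<in>C. ideal_ball s m)"
    using assms(2) unfolding balls_def by (rule compactE_image[OF _ open_ideal_ball])
  obtain l where "set l = C" using C(2) finite_list by blast
  with C show ?thesis by (intro exI[of _ l]) auto
qed

lemma compact_subset_open:
  assumes "compact K" "open U" "K \<subseteq> U"
  shows "\<exists>l. K \<subseteq> (\<Union>m\<in>set l. ideal_ball s m) \<and> (\<Union>m\<in>set l. ideal_cball s m) \<subseteq> U"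
proof -
  have "K \<subseteq> balls s (\<lambda>m. ideal_cball s m \<subseteq> U)"
    using open_contains_ideal_cball[OF assms(2)] assms(3) unfolding subset_iff mem_balls by blast
  from compact_subset_balls[OF assms(1) this] show ?thesis by auto
qed

text \<open>Programs are deterministic, so the approximation computed by \<open>p\<close> is the promised one.\<close>

lemma dist_less_iff:
  assumes p: "\<And>i j n. \<exists>y. evaluates p [i, j, n] y \<and> \<bar>dist (s i) (s j) - rat_of_code y\<bar> \<le> 1 / 2 ^ n"
  shows "dist (s i) (s j) < q \<longleftrightarrow> (\<exists>n y. evaluates p [i, j, n] y \<and> rat_of_code y + 1 / 2 ^ n < q)"
    and "q < dist (s i) (s j) \<longleftrightarrow> (\<exists>n y. evaluates p [i, j, n] y \<and> q < rat_of_code y - 1 / 2 ^ n)"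
proof -
  have approx: "\<bar>dist (s i) (s j) - rat_of_code y\<bar> \<le> 1 / 2 ^ n" if "evaluates p [i, j, n] y" for n y
    using p[of i j n] evaluates_deterministic[OF that] by blast
  \<comment> \<open>The factor 2 pays once for the error of the output and once for the margin
    demanded by the test.\<close>
  have small: "\<exists>n. 2 * (1 / 2 ^ n) < (\<epsilon> :: real)" if "\<epsilon> > 0" for \<epsilon>
    using real_arch_pow_inv[of "\<epsilon> / 2" "1 / 2"] that by (auto simp: power_one_over field_simps)
  show "dist (s i) (s j) < q \<longleftrightarrow> (\<exists>n y. evaluates p [i, j, n] y \<and> rat_of_code y + 1 / 2 ^ n < q)"
  proof
    assume "dist (s i) (s j) < q"
    then obtain n where n: "2 * (1 / 2 ^ n) < q - dist (s i) (s j)" using small by fastforce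
    obtain y where "evaluates p [i, j, n] y" "\<bar>dist (s i) (s j) - rat_of_code y\<bar> \<le> 1 / 2 ^ n" using p by blast
    with n show "\<exists>n y. evaluates p [i, j, n] y \<and> rat_of_code y + 1 / 2 ^ n < q"
      by (intro exI[of _ n] exI[of _ y]) linarith
  qed (use approx in force)
  show "q < dist (s i) (s j) \<longleftrightarrow> (\<exists>n y. evaluates p [i, j, n] y \<and> q < rat_of_code y - 1 / 2 ^ n)"
  proof
    assume "q < dist (s i) (s j)"
    then obtain n where n: "2 * (1 / 2 ^ n) < dist (s i) (s j) - q" using small by fastforce
    obtain y where "evaluates p [i, j, n] y" "\<bar>dist (s i) (s j) - rat_of_code y\<bar> \<le> 1 / 2 ^ n" using p by blast
    with n show "\<exists>n y. evaluates p [i, j, n] y \<and> q < rat_of_code y - 1 / 2 ^ n"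
      by (intro exI[of _ n] exI[of _ y]) linarith
  qed (use approx in force)
qed

lemma sigma_dist:
  assumes "computable f" "computable g" "computable_rat q"
  shows "sigma 1 (\<lambda>e. dist (s (f e)) (s (g e)) < q e)" "sigma 1 (\<lambda>e. q e < dist (s (f e)) (s (g e)))"
proof -
  obtain p where p: "\<And>i j n. \<exists>y. evaluates p [i, j, n] y \<and> \<bar>dist (s i) (s j) - rat_of_code y\<bar> \<le> 1 / 2 ^ n"
    using computable_metric unfolding computable_metric_space_def by blast
  show "sigma 1 (\<lambda>e. dist (s (f e)) (s (g e)) < q e)" "sigma 1 (\<lambda>e. q e < dist (s (f e)) (s (g e)))"
    unfolding dist_less_iff[OF p]
    by (intro sigma_intros sigma_decidable decidable_intros computable_rat_intros computable_intros
        assms(1,2)[THEN computable_compose] computable_rat_compose[OF assms(3)])+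
qed

lemma sigma_far [sigma_intros]:
  assumes "computable f" "computable g" shows "sigma 1 (\<lambda>e. far s (f e) (g e))"
  unfolding far_def by (intro sigma_dist computable_intros computable_rat_intros assms)

lemma sigma_mem_ideal_ball [sigma_intros]:
  assumes "computable f" "computable g" shows "sigma 1 (\<lambda>e. s (f e) \<in> ideal_ball s (g e))"
  unfolding ideal_ball_def mem_ball by (intro sigma_dist computable_intros computable_rat_intros assms)

text \<open>A finite list of balls already covers, and recursive compactness makes covering by a
  list a halting problem. The list is existentially quantified and its members are tested under a
  bounded quantifier, so the level stays that of \<open>E\<close>.\<close>

lemma sigma_balls_UNIV [sigma_intros]:
  assumes "sigma n (\<lambda>p. E (fst (prod_decode p)) (snd (prod_decode p)))" "n \<noteq> 0"
  shows "sigma n (\<lambda>e. balls s (\<lambda>m. E m e) = UNIV)"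
proof -
  obtain p where p: "\<And>is. halts p [list_encode is] \<longleftrightarrow> UNIV \<subseteq> (\<Union>i\<in>set is. ideal_ball s i)"
    using recursively_compact_UNIV unfolding recursively_compact_def by blast
  have "balls s (\<lambda>m. E m e) = UNIV \<longleftrightarrow> (\<exists>l. halts p [list_encode l] \<and> (\<forall>m\<in>set l. E m e))" for e
  proof
    assume "balls s (\<lambda>m. E m e) = UNIV"
    then show "\<exists>l. halts p [list_encode l] \<and> (\<forall>m\<in>set l. E m e)"
      using compact_subset_balls[OF compact_UNIV, of "\<lambda>m. E m e"] p by auto
  qed (auto simp: p balls_def)
  moreover have "sigma n (\<lambda>e. \<exists>l. halts p [list_encode l] \<and> (\<forall>m\<in>set l. E m e))"
  proof (intro sigma_intros assms(2))
    show "sigma n (\<lambda>e. halts p [list_encode (list_decode (fst (prod_decode e)))])"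
      by (rule sigma_of_sigma_1[OF sigma_halts assms(2)]) (intro computable_intros)
    show "computable (\<lambda>e. list_encode (list_decode (fst (prod_decode e))))"
      by (intro computable_intros)
    have "sigma n (\<lambda>p. (\<lambda>p. E (fst (prod_decode p)) (snd (prod_decode p)))
       (prod_encode (fst (prod_decode p), snd (prod_decode (snd (prod_decode p))))))"
      by (rule sigma_compose[OF assms(1)]) (intro computable_intros)
    then show "sigma n (\<lambda>p. E (fst (prod_decode p)) (snd (prod_decode (snd (prod_decode p)))))"
      by simp
  qed
  ultimately show ?thesis by simp
qed

text \<open>Adding the effective open complement of the closed ball turns the inclusion into a
  covering of the whole space.\<close>

lemma sigma_ideal_cball_subset [sigma_intros]:
  assumes "sigma n (\<lambda>p. E (fst (prod_decode p)) (snd (prod_decode p)))" "computable f" "n \<noteq> 0"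
  shows "sigma n (\<lambda>e. ideal_cball s (f e) \<subseteq> balls s (\<lambda>m. E m e))"
proof -
  have "ideal_cball s (f e) \<subseteq> balls s (\<lambda>m. E m e) \<longleftrightarrow> balls s (\<lambda>m. E m e \<or> far s m (f e)) = UNIV" for e
  proof -
    have "balls s (\<lambda>m. E m e \<or> far s m (f e)) = balls s (\<lambda>m. E m e) \<union> - ideal_cball s (f e)"
      unfolding Compl_ideal_cball by (auto simp: balls_def)
    then show ?thesis by blast
  qed
  moreover have "sigma n (\<lambda>e. balls s (\<lambda>m. E m e \<or> far s m (f e)) = UNIV)"
  proof (intro sigma_intros assms)
    show "sigma n (\<lambda>p. far s (fst (prod_decode p)) (f (snd (prod_decode p))))"
      by (rule sigma_of_sigma_1[OF sigma_far assms(3)]) (intro computable_intros computable_compose[OF assms(2)])+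
  qed
  ultimately show ?thesis by simp
qed

end

section \<open>Iterates of a map on ideal balls\<close>

definition enum_rel :: "recf \<Rightarrow> (nat \<times> nat) set" where
  "enum_rel p = {(l, m). m \<in> enumerated p l}"

lemma sigma_enum_rel: "sigma 1 (\<lambda>e. (fst (prod_decode e), snd (prod_decode e)) \<in> enum_rel p)"
  unfolding enum_rel_def mem_Collect_eq prod.case by (intro sigma_intros computable_intros)

lemmas sigma_enum_rel_relpow [sigma_intros] = sigma_relpow[OF sigma_enum_rel]

lemma funpow_image_ideal_ball:
  assumes "\<And>m. T ` ideal_ball s m = (\<Union>i\<in>enumerated p m. ideal_ball s i)"
  shows "(T ^^ k) ` ideal_ball s j = balls s (\<lambda>m. (j, m) \<in> enum_rel p ^^ k)"
proof (induction k)
  case (Suc k)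
  have "(T ^^ Suc k) ` ideal_ball s j = T ` ((T ^^ k) ` ideal_ball s j)"
    by (simp add: image_comp)
  also have "\<dots> = balls s (\<lambda>m. (j, m) \<in> enum_rel p ^^ Suc k)"
    by (auto simp: Suc.IH balls_def image_UN assms enum_rel_def relcomp_unfold)
  finally show ?case .
qed (auto simp: balls_def)

lemma funpow_vimage_ideal_ball:
  assumes "\<And>m. T -` ideal_ball s m = (\<Union>i\<in>enumerated p m. ideal_ball s i)"
  shows "(T ^^ k) -` ideal_ball s j = balls s (\<lambda>m. (j, m) \<in> enum_rel p ^^ k)"
proof (induction k)
  case (Suc k)
  have "(T ^^ Suc k) -` ideal_ball s j = T -` ((T ^^ k) -` ideal_ball s j)"
    by (simp add: vimage_comp funpow_Suc_right del: funpow.simps)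
  also have "\<dots> = balls s (\<lambda>m. (j, m) \<in> enum_rel p ^^ Suc k)"
    by (auto simp: Suc.IH balls_def vimage_UN assms enum_rel_def relcomp_unfold)
  finally show ?case .
qed (auto simp: balls_def)

text \<open>The program for preimages is a parameter, so that \<open>enum_rel p\<close> can occur in
  the formulas whose complexity is read off.\<close>

locale computable_system = recursively_compact_space s
  for s :: "nat \<Rightarrow> 'a::metric_space" +
  fixes T :: "'a \<Rightarrow> 'a" and p :: recf
  assumes vimage_ideal_ball: "\<And>m. T -` ideal_ball s m = (\<Union>i\<in>enumerated p m. ideal_ball s i)"
begin

lemmas funpow_vimage = funpow_vimage_ideal_ball[OF vimage_ideal_ball]

lemma funpow_in_ideal_ball:
  "(T ^^ k) x \<in> ideal_ball s j \<longleftrightarrow> (\<exists>m. (j, m) \<in> enum_rel p ^^ k \<and> x \<in> ideal_ball s m)"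
  by (simp add: funpow_vimage mem_balls flip: vimage_eq)

lemma open_funpow_vimage:
  assumes "open U" shows "open ((T ^^ k) -` U)"
proof -
  have "(T ^^ k) -` U = (\<Union>m\<in>{m. ideal_ball s m \<subseteq> U}. (T ^^ k) -` ideal_ball s m)"
    using open_contains_ideal_cball[OF assms] ideal_ball_subset_cball by fast
  then show ?thesis
    by (auto simp: funpow_vimage open_balls)
qed

lemma continuous_on_funpow: "continuous_on S (T ^^ k)"
  by (rule continuous_on_subset[of UNIV]) (auto simp: continuous_on_open_vimage open_funpow_vimage)

lemma funpow_vimage_Compl_ideal_cball:
  "(T ^^ k) -` (- ideal_cball s j) = balls s (\<lambda>m. \<exists>l. far s l j \<and> (l, m) \<in> enum_rel p ^^ k)"
  unfolding Compl_ideal_cball set_eq_iff vimage_eq mem_balls funpow_in_ideal_ball by blast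

text \<open>Disjointness says that the closed ball \<open>i\<close> lies in the preimage of the
  complement of the closed ball \<open>j\<close>. With closed balls in both places this is a compact
  set inside an effective open one.\<close>

lemma sigma_disjoint [sigma_intros]:
  assumes "computable k" "computable i" "computable j"
  shows "sigma 1 (\<lambda>e. (T ^^ k e) ` ideal_cball s (i e) \<inter> ideal_cball s (j e) = {})"
proof -
  have "(T ^^ k) ` ideal_cball s i \<inter> ideal_cball s j = {} \<longleftrightarrow>
     ideal_cball s i \<subseteq> balls s (\<lambda>m. \<exists>l. far s l j \<and> (l, m) \<in> enum_rel p ^^ k)" for k i j
    unfolding funpow_vimage_Compl_ideal_cball[symmetric] by blast
  then show ?thesis
    by (simp only:) (intro sigma_intros computable_intros assms assms[THEN computable_compose])
qed

end

section \<open>Attractors\<close>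

lemma sigma_2_not: "sigma 1 P \<Longrightarrow> sigma 2 (\<lambda>e. \<not> P e)"
  using sigma_not[of 1 P] by (simp add: numeral_2_eq_2)

text \<open>Lower computability speaks of finite unions; continuity from below carries a strict
  lower bound over to infinite ones. Strictness lets a single rational approximation of a single
  finite union witness the bound.\<close>

lemma sigma_less_half_measure:
  fixes s :: "nat \<Rightarrow> 'a::metric_space"
  assumes M: "computable_measure s M"
    and E: "sigma 1 (\<lambda>p. E (fst (prod_decode p)) (snd (prod_decode p)))"
  shows "sigma 1 (\<lambda>e. 1 / 2 < measure M (balls s (\<lambda>m. E m e)))"
proof -
  obtain p f where p: "\<And>is k. evaluates p [list_encode is, k] (f is k)"
    and f: "\<And>is. (SUP k. ereal (rat_of_code (f is k))) = ereal (measure M (\<Union>i\<in>set is. ideal_ball s i))"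
    using M unfolding computable_measure_def by blast
  interpret prob_space M using M by (simp add: computable_measure_def borel_prob_def)
  have sets: "open U \<Longrightarrow> U \<in> sets M" for U
    using M by (simp add: computable_measure_def borel_prob_def)
  have approx: "1 / 2 < measure M (\<Union>i\<in>set is. ideal_ball s i) \<longleftrightarrow>
      (\<exists>k y. evaluates p [list_encode is, k] y \<and> 1 / 2 < rat_of_code y)" for "is"
  proof -
    have "1 / 2 < measure M (\<Union>i\<in>set is. ideal_ball s i) \<longleftrightarrow>
        ereal (1 / 2) < (SUP k. ereal (rat_of_code (f is k)))"
      unfolding f by simp
    also have "\<dots> \<longleftrightarrow> (\<exists>k. 1 / 2 < rat_of_code (f is k))"
      unfolding less_SUP_iff by simp
    also have "\<dots> \<longleftrightarrow> (\<exists>k y. evaluates p [list_encode is, k] y \<and> 1 / 2 < rat_of_code y)"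
      using p evaluates_deterministic by metis
    finally show ?thesis .
  qed
  have "1 / 2 < measure M (balls s (\<lambda>m. E m e)) \<longleftrightarrow>
    (\<exists>l k y. (\<forall>m\<in>set l. E m e) \<and> evaluates p [list_encode l, k] y \<and> 1 / 2 < rat_of_code y)" for e
  proof
    assume less: "1 / 2 < measure M (balls s (\<lambda>m. E m e))"
    define B where "B n = (\<Union>m\<in>{m. m < n \<and> E m e}. ideal_ball s m)" for n
    have "(\<lambda>n. measure M (B n)) \<longlonglongrightarrow> measure M (\<Union>n. B n)"
    proof (rule finite_Lim_measure_incseq)
      show "range B \<subseteq> sets M" by (auto simp: B_def intro!: sets open_ideal_ball)
      show "incseq B" unfolding incseq_def B_def by (intro allI impI UN_mono) auto
    qed
    moreover have "(\<Union>n. B n) = balls s (\<lambda>m. E m e)"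
      by (auto simp: B_def balls_def)
    ultimately have "(\<lambda>n. measure M (B n)) \<longlonglongrightarrow> measure M (balls s (\<lambda>m. E m e))" by simp
    from order_tendstoD(1)[OF this less] obtain n where n: "1 / 2 < measure M (B n)"
      by (auto simp: eventually_sequentially)
    have "B n = (\<Union>m\<in>set (filter (\<lambda>m. E m e) [0..<n]). ideal_ball s m)"
      by (auto simp: B_def)
    with n obtain k y where "evaluates p [list_encode (filter (\<lambda>m. E m e) [0..<n]), k] y" "1 / 2 < rat_of_code y"
      using approx by metis
    then show "\<exists>l k y. (\<forall>m\<in>set l. E m e) \<and> evaluates p [list_encode l, k] y \<and> 1 / 2 < rat_of_code y"
      by (intro exI[of _ "filter (\<lambda>m. E m e) [0..<n]"] exI[of _ k] exI[of _ y]) auto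
  next
    assume "\<exists>l k y. (\<forall>m\<in>set l. E m e) \<and> evaluates p [list_encode l, k] y \<and> 1 / 2 < rat_of_code y"
    then obtain l where l: "\<And>m. m \<in> set l \<Longrightarrow> E m e" "1 / 2 < measure M (\<Union>i\<in>set l. ideal_ball s i)"
      using approx by blast
    have "measure M (\<Union>i\<in>set l. ideal_ball s i) \<le> measure M (balls s (\<lambda>m. E m e))"
      by (rule finite_measure_mono) (use l in \<open>auto simp: balls_def intro!: sets open_UN open_ideal_ball\<close>)
    with l show "1 / 2 < measure M (balls s (\<lambda>m. E m e))" by simp
  qed
  moreover have "sigma 1 (\<lambda>e. \<exists>l k y. (\<forall>m\<in>set l. E m e) \<and> evaluates p [list_encode l, k] y \<and> 1 / 2 < rat_of_code y)"
  proof -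
    have E': "sigma 1 (\<lambda>q. E (f q) (g q))" if "computable f" "computable g" for f g
      using sigma_compose[OF E computable_basic(7)[OF that]] by simp
    show ?thesis
      by (intro sigma_intros sigma_decidable decidable_intros computable_rat_intros computable_intros E')
  qed
  ultimately show ?thesis by simp
qed

section \<open>Baire category, limit sets and realms of attraction\<close>

lemma generic_Int: "generic S \<Longrightarrow> generic S' \<Longrightarrow> generic (S \<inter> S')"
proof -
  assume "generic S" "generic S'"
  then obtain G G' :: "nat \<Rightarrow> 'a set" where
    G: "\<And>n. open (G n) \<and> closure (G n) = UNIV" "(\<Inter>n. G n) \<subseteq> S" and
    G': "\<And>n. open (G' n) \<and> closure (G' n) = UNIV" "(\<Inter>n. G' n) \<subseteq> S'"
    unfolding generic_def by metis
  let ?H = "\<lambda>n. if even n then G (n div 2) else G' (n div 2)"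
  have "x \<in> S \<inter> S'" if "x \<in> (\<Inter>n. ?H n)" for x
  proof -
    have x: "x \<in> ?H n" for n using that by (rule INT_D) simp
    have "x \<in> G n" "x \<in> G' n" for n
      using x[of "2 * n"] x[of "Suc (2 * n)"] by simp_all
    then show ?thesis using G(2) G'(2) by blast
  qed
  then have "(\<Inter>n. ?H n) \<subseteq> S \<inter> S'" by (rule subsetI)
  moreover have "\<forall>n. open (?H n) \<and> closure (?H n) = UNIV" using G(1) G'(1) by simp
  ultimately show "generic (S \<inter> S')" unfolding generic_def by (intro exI[of _ ?H] conjI)
qed

text \<open>Baire's theorem for locally compact regular spaces; both properties come from the
  compactness of the metric space.\<close>

lemma (in recursively_compact_space) generic_dense:
  fixes S :: "'a set"
  assumes "generic S" shows "closure S = UNIV"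
proof -
  obtain G :: "nat \<Rightarrow> 'a set" where G: "\<And>n. open (G n) \<and> closure (G n) = UNIV" "(\<Inter>n. G n) \<subseteq> S"
    using assms unfolding generic_def by blast
  have "compact_space (euclidean :: 'a topology)"
    using compact_UNIV by (simp add: compact_space_def)
  then have "locally_compact_space (euclidean :: 'a topology) \<and> regular_space (euclidean :: 'a topology)"
    by (intro conjI compact_imp_locally_compact_space compact_Hausdorff_imp_regular_space) auto
  then have "euclidean closure_of \<Inter>(range G) = topspace (euclidean :: 'a topology)"
    by (intro Baire_category) (use G(1) in auto)
  then have "closure (\<Inter>n. G n) = UNIV" by simp
  then show ?thesis using closure_mono[OF G(2)] by auto
qed

lemma omega_limit_frequently:
  "open U \<Longrightarrow> omega_limit T x \<inter> U \<noteq> {} \<Longrightarrow> \<exists>\<^sub>F n in sequentially. (T ^^ n) x \<in> U"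
  unfolding omega_limit_def by blast

text \<open>Otherwise every point of \<open>K\<close> has a neighbourhood that the orbit eventually
  leaves. Finitely many of these cover \<open>K\<close>, so the orbit would eventually avoid
  \<open>K\<close>.\<close>

lemma compact_frequently_omega_limit:
  assumes "compact K" "\<exists>\<^sub>F n in sequentially. (T ^^ n) x \<in> K"
  shows "omega_limit T x \<inter> K \<noteq> {}"
proof
  assume empty: "omega_limit T x \<inter> K = {}"
  have "\<exists>U. open U \<and> y \<in> U \<and> (\<forall>\<^sub>F n in sequentially. (T ^^ n) x \<notin> U)" if "y \<in> K" for y
    using empty that unfolding omega_limit_def not_frequently[symmetric] by blast
  then obtain U where U: "\<And>y. y \<in> K \<Longrightarrow> open (U y)" "\<And>y. y \<in> K \<Longrightarrow> y \<in> U y"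
    "\<And>y. y \<in> K \<Longrightarrow> \<forall>\<^sub>F n in sequentially. (T ^^ n) x \<notin> U y" by metis
  have "K \<subseteq> (\<Union>y\<in>K. U y)" using U(2) by blast
  with assms(1) U(1) obtain C where C: "C \<subseteq> K" "finite C" "K \<subseteq> (\<Union>y\<in>C. U y)"
    by (rule compactE_image)
  have "\<forall>\<^sub>F n in sequentially. \<forall>y\<in>C. (T ^^ n) x \<notin> U y"
    using C(1,2) U(3) by (intro eventually_ball_finite) auto
  then have "\<forall>\<^sub>F n in sequentially. (T ^^ n) x \<notin> K"
    by (rule eventually_mono) (use C(3) in blast)
  with assms(2) show False by (simp add: frequently_def)
qed

text \<open>The form in which minimality of an attractor enters: when the ball \<open>B\<close>
  meets \<open>A\<close>, the closed set \<open>A - B\<close> is strictly smaller, so most points,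
  in category or in measure, satisfy the two hypotheses on \<open>x\<close>.\<close>

lemma realm_frequently:
  assumes "x \<in> realm T A" "x \<notin> realm T (A - B)" "open B"
  shows "\<exists>k\<ge>n. (T ^^ k) x \<in> B"
proof -
  have "omega_limit T x \<inter> B \<noteq> {}" using assms(1,2) unfolding realm_def by blast
  from omega_limit_frequently[OF assms(3) this] show ?thesis
    unfolding frequently_sequentially by blast
qed

lemma realm_eventually_avoids:
  assumes "x \<in> realm T A" "compact K" "K \<inter> A = {}"
  shows "\<exists>n. \<forall>k\<ge>n. (T ^^ k) x \<notin> K"
proof (rule ccontr)
  assume "\<not> ?thesis"
  then have "\<exists>\<^sub>F n in sequentially. (T ^^ n) x \<in> K"
    unfolding frequently_sequentially by blast
  from compact_frequently_omega_limit[OF assms(2) this] assms(1,3) show False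
    unfolding realm_def by blast
qed

section \<open>Outer collections of topological, metric and strong attractors\<close>

context computable_system
begin

text \<open>\<open>Z\<close> has to be right only up to the bounding sphere: it lies between the
  condition that the closed ball misses \<open>A\<close> and the weaker one that the open ball does.
  Asking for \<open>Z\<close> at a slightly larger concentric ball removes the ambiguity.\<close>

lemma Pi_compactI:
  assumes "closed A" "sigma n Z" "n \<noteq> 0"
    and "\<And>j. Z j \<Longrightarrow> ideal_ball s j \<inter> A = {}"
    and "\<And>j. ideal_cball s j \<inter> A = {} \<Longrightarrow> Z j"
  shows "Pi_compact s n A"
proof -
  have "ideal_cball s i \<inter> A = {} \<longleftrightarrow>
      (\<exists>j. centre i = centre j \<and> radius i < radius j \<and> Z j)" for i
  proof
    assume disj: "ideal_cball s i \<inter> A = {}"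
    show "\<exists>j. centre i = centre j \<and> radius i < radius j \<and> Z j"
    proof -
      \<comment> \<open>The distance from the centre attains its minimum on the compact set
        \<open>A\<close>; this leaves room for the larger ball.\<close>
      have "\<exists>\<delta>>0. \<forall>y\<in>A. radius i + \<delta> < dist (s (centre i)) y"
      proof (cases "A = {}")
        case False
        have "compact A" using assms(1) by (rule closed_imp_compact)
        obtain a where a: "a \<in> A" "\<And>y. y \<in> A \<Longrightarrow> dist (s (centre i)) a \<le> dist (s (centre i)) y"
          using continuous_attains_inf[OF \<open>compact A\<close> False, of "dist (s (centre i))"]
            continuous_on_dist[OF continuous_on_const continuous_on_id] by blast
        have "a \<notin> ideal_cball s i" using disj a(1) by blast
        then have "radius i < dist (s (centre i)) a" by (simp add: ideal_cball_def)
        with a(2) show ?thesis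
          by (intro exI[of _ "(dist (s (centre i)) a - radius i) / 2"]) (fastforce simp: field_simps)
      qed (auto intro: exI[of _ 1])
      then obtain \<delta> where \<delta>: "\<delta> > 0" "\<And>y. y \<in> A \<Longrightarrow> radius i + \<delta> < dist (s (centre i)) y" by blast
      obtain j where j: "centre j = centre i" "radius i < radius j" "radius j < radius i + \<delta>"
        using exists_concentric[of "radius i" "radius i + \<delta>" i] \<delta>(1) radius_pos[of i] by auto
      then have "ideal_cball s j \<inter> A = {}"
        using \<delta>(2) by (fastforce simp: ideal_cball_def)
      with j assms(5) show ?thesis by metis
    qed
  next
    assume "\<exists>j. centre i = centre j \<and> radius i < radius j \<and> Z j"
    then show "ideal_cball s i \<inter> A = {}"
      using assms(4) ideal_cball_subset_ball by blast
  qed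
  moreover have "sigma n (\<lambda>i. \<exists>j. centre i = centre j \<and> radius i < radius j \<and> Z j)"
    by (intro sigma_intros sigma_compose[OF assms(2)] sigma_decidable decidable_intros computable_rat_intros
        computable_intros assms(3))
  ultimately show ?thesis
    unfolding Pi_compact_def Sigma_set_iff_sigma using closed_imp_compact[OF assms(1)] by simp
qed

definition visits_from :: "nat \<Rightarrow> nat \<Rightarrow> 'a set" where
  "visits_from j n = {x. \<exists>k\<ge>n. (T ^^ k) x \<in> ideal_ball s j}"

lemma visits_from_eq_balls:
  "visits_from j n = balls s (\<lambda>m. \<exists>k. n \<le> k \<and> (j, m) \<in> enum_rel p ^^ k)"
  unfolding visits_from_def set_eq_iff mem_balls mem_Collect_eq funpow_in_ideal_ball by blast

lemma open_visits_from: "open (visits_from j n)"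
  unfolding visits_from_eq_balls by (rule open_balls)

lemma topological_attractor_Pi:
  assumes "topological_attractor T A" shows "Pi_compact s 2 A"
proof (rule Pi_compactI)
  \<comment> \<open>Some ball \<open>W\<close> misses some \<open>visits_from j n\<close>. Both sets
    are open, so an empty intersection can be tested on ideal points: a Pi_1 condition behind
    existential quantifiers.\<close>
  let ?Z = "\<lambda>j. \<exists>n W. \<not> (\<exists>l m k. s l \<in> ideal_ball s W \<and> n \<le> k \<and> (j, m) \<in> enum_rel p ^^ k \<and> s l \<in> ideal_ball s m)"
  have clo: "closed A" and gen: "generic (realm T A)"
    and min: "\<And>A'. closed A' \<Longrightarrow> A' \<subset> A \<Longrightarrow> generic (- realm T A')"
    using assms unfolding topological_attractor_def meager_def by blast+
  have Z: "?Z j \<longleftrightarrow> (\<exists>n W. ideal_ball s W \<inter> visits_from j n = {})" for j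
  proof -
    have "(\<exists>l m k. s l \<in> ideal_ball s W \<and> n \<le> k \<and> (j, m) \<in> enum_rel p ^^ k \<and> s l \<in> ideal_ball s m)
      \<longleftrightarrow> (\<exists>l. s l \<in> ideal_ball s W \<inter> visits_from j n)" for n W
      unfolding visits_from_eq_balls Int_iff mem_balls by blast
    also have "(\<exists>l. s l \<in> ideal_ball s W \<inter> visits_from j n) \<longleftrightarrow> ideal_ball s W \<inter> visits_from j n \<noteq> {}" for n W
      using exists_ideal_point[OF open_Int[OF open_ideal_ball open_visits_from]] by blast
    finally show ?thesis by simp
  qed
  show "closed A" by (rule clo)
  show "sigma 2 ?Z"
    by (intro sigma_ex one_two_neq_0 sigma_2_not;
        intro sigma_intros sigma_decidable decidable_intros computable_intros)
  show "(2::nat) \<noteq> 0" by simp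
  show "ideal_ball s j \<inter> A = {}" if Zj: "?Z j" for j
  proof (rule ccontr)
    assume "ideal_ball s j \<inter> A \<noteq> {}"
    \<comment> \<open>Without the ball, \<open>A\<close> shrinks to a closed set with meager realm.
      The points attracted to \<open>A\<close> but not to that set are generic, hence dense, and lie
      in every \<open>visits_from j n\<close>.\<close>
    then have "generic (- realm T (A - ideal_ball s j))"
      by (intro min closed_Diff clo open_ideal_ball) auto
    with gen have "generic (realm T A \<inter> - realm T (A - ideal_ball s j))" by (rule generic_Int)
    then have dense: "closure (realm T A \<inter> - realm T (A - ideal_ball s j)) = UNIV" by (rule generic_dense)
    have "realm T A \<inter> - realm T (A - ideal_ball s j) \<subseteq> visits_from j n" for n
      using realm_frequently[OF _ _ open_ideal_ball] unfolding visits_from_def by blast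
    moreover obtain n W where W: "ideal_ball s W \<inter> visits_from j n = {}" using Zj unfolding Z by blast
    ultimately have "ideal_ball s W \<inter> (realm T A \<inter> - realm T (A - ideal_ball s j)) = {}"
      using Int_mono[OF subset_refl, of _ "visits_from j n" "ideal_ball s W"] unfolding W by blast
    then have "ideal_ball s W \<inter> closure (realm T A \<inter> - realm T (A - ideal_ball s j)) = {}"
      by (simp only: open_Int_closure_eq_empty[OF open_ideal_ball])
    then have "ideal_ball s W = {}" unfolding dense by simp
    then show False using radius_pos[of W] by (simp add: ideal_ball_def)
  qed
  show "?Z j" if disj: "ideal_cball s j \<inter> A = {}" for j
  proof (rule ccontr)
    assume "\<not> ?Z j"
    then have meets: "\<And>n W. ideal_ball s W \<inter> visits_from j n \<noteq> {}" unfolding Z by blast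
    have "closure (visits_from j n) = UNIV" for n
    proof (rule ccontr)
      assume "closure (visits_from j n) \<noteq> UNIV"
      then obtain x where "x \<in> - closure (visits_from j n)" by blast
      then obtain W where "ideal_cball s W \<subseteq> - closure (visits_from j n)"
        using open_contains_ideal_cball[of "- closure (visits_from j n)"] by auto
      then show False
        using meets[of W n] ideal_ball_subset_cball[of s W] closure_subset[of "visits_from j n"] by blast
    qed
    \<comment> \<open>Infinitely many visits would be generic, so some point attracted to
      \<open>A\<close> would accumulate in the closed ball, which misses \<open>A\<close>.\<close>
    then have "generic (\<Inter>n. visits_from j n)"
      unfolding generic_def using open_visits_from by (intro exI[of _ "visits_from j"]) simp
    from generic_dense[OF generic_Int[OF gen this]]
    have "realm T A \<inter> (\<Inter>n. visits_from j n) \<noteq> {}" by (metis closure_empty UNIV_not_empty)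
    then obtain x where x: "x \<in> realm T A" "\<And>n. x \<in> visits_from j n" by blast
    from realm_eventually_avoids[OF x(1) closed_imp_compact[OF closed_ideal_cball] disj]
    show False using x(2) ideal_ball_subset_cball unfolding visits_from_def by blast
  qed
qed

text \<open>Measurability has to be secured because \<open>measure\<close> defaults to 0 on other
  sets. Countably many conditions suffice: a limit point outside \<open>A\<close> has around it a
  closed ideal ball that misses \<open>A\<close>.\<close>

lemma borel_realm:
  assumes "closed A" shows "realm T A \<in> sets borel"
proof -
  have "x \<in> realm T A \<longleftrightarrow> (\<forall>i\<in>{i. ideal_cball s i \<inter> A = {}}. \<exists>n. \<forall>k\<ge>n. (T ^^ k) x \<in> - ideal_cball s i)" (is "_ \<longleftrightarrow> ?R") for x
  proof
    assume "x \<in> realm T A"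
    then show ?R using realm_eventually_avoids[OF _ closed_imp_compact[OF closed_ideal_cball]] by fastforce
  next
    assume R: ?R
    show "x \<in> realm T A"
    proof (rule ccontr)
      assume "x \<notin> realm T A"
      then obtain y where y: "y \<in> omega_limit T x" "y \<in> - A" unfolding realm_def by blast
      obtain m where m: "y \<in> ideal_ball s m" "ideal_cball s m \<subseteq> - A"
        using open_contains_ideal_cball[of "- A" y] assms y(2) by auto
      have "\<exists>\<^sub>F n in sequentially. (T ^^ n) x \<in> ideal_ball s m"
        by (rule omega_limit_frequently[OF open_ideal_ball]) (use y m in blast)
      moreover obtain n where "\<forall>k\<ge>n. (T ^^ k) x \<in> - ideal_cball s m" using R m by blast
      ultimately show False
        using ideal_ball_subset_cball[of s m] unfolding frequently_sequentially by blast
    qed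
  qed
  then have "realm T A = (\<Inter>i\<in>{i. ideal_cball s i \<inter> A = {}}. \<Union>n. \<Inter>k\<in>{n..}. (T ^^ k) -` (- ideal_cball s i))"
    by (intro set_eqI) (simp only: INT_iff UN_iff vimage_eq bex_UNIV Ball_def atLeast_iff)
  also have "\<dots> \<in> sets borel"
  proof (cases "{i. ideal_cball s i \<inter> A = {}} = {}")
    case False
    have "(T ^^ k) -` (- ideal_cball s i) \<in> sets borel" for k i
      by (intro borel_open open_funpow_vimage open_Compl closed_ideal_cball)
    then show ?thesis using False by (intro sets.countable_INT' sets.countable_UN) auto
  qed simp
  finally show ?thesis .
qed

lemma metric_attractor_Pi:
  assumes "computable_measure s lam" "metric_attractor lam T A" shows "Pi_compact s 2 A"
proof (rule Pi_compactI)
  interpret prob_space lam using assms(1) by (simp add: computable_measure_def borel_prob_def)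
  have sets: "sets lam = sets borel"
    using assms(1) by (simp add: computable_measure_def borel_prob_def)
  \<comment> \<open>For a ball that meets \<open>A\<close> all these measures are 1; if its closed
    ball misses \<open>A\<close> they tend to 0. Any threshold strictly between 0 and 1 separates
    the cases.\<close>
  let ?Z = "\<lambda>j. \<exists>n. \<not> 1 / 2 < measure lam (visits_from j n)"
  have clo: "closed A" and full: "measure lam (realm T A) = 1"
    and min: "\<And>A'. closed A' \<Longrightarrow> A' \<subset> A \<Longrightarrow> \<not> measure lam (realm T A') > 0"
    using assms(2) unfolding metric_attractor_def by blast+
  show "closed A" by (rule clo)
  show "sigma 2 ?Z"
    unfolding visits_from_eq_balls
    by (intro sigma_ex one_two_neq_0 sigma_2_not sigma_less_half_measure[OF assms(1)];
        intro sigma_intros sigma_decidable decidable_intros computable_intros)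
  show "(2::nat) \<noteq> 0" by simp
  show "ideal_ball s j \<inter> A = {}" if Zj: "?Z j" for j
  proof (rule ccontr)
    let ?A' = "A - ideal_ball s j"
    assume "ideal_ball s j \<inter> A \<noteq> {}"
    then have "\<not> measure lam (realm T ?A') > 0"
      by (intro min closed_Diff clo open_ideal_ball) auto
    then have 0: "measure lam (realm T ?A') = 0"
      using measure_nonneg[of lam "realm T ?A'"] by linarith
    obtain n where n: "\<not> 1 / 2 < measure lam (visits_from j n)" using Zj by blast
    have meas: "realm T ?A' \<in> sets lam" "visits_from j n \<in> sets lam"
      unfolding sets by (intro borel_realm closed_Diff clo open_ideal_ball borel_open open_visits_from)+
    have "realm T A \<subseteq> realm T ?A' \<union> visits_from j n"
      using realm_frequently[OF _ _ open_ideal_ball] unfolding visits_from_def by blast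
    then have "measure lam (realm T A) \<le> measure lam (realm T ?A' \<union> visits_from j n)"
      by (rule finite_measure_mono) (intro sets.Un meas)
    also have "\<dots> \<le> measure lam (realm T ?A') + measure lam (visits_from j n)"
      using meas by (rule measure_Un_le)
    finally show False using n 0 full by simp
  qed
  show "?Z j" if disj: "ideal_cball s j \<inter> A = {}" for j
  proof -
    \<comment> \<open>The sets decrease to the points visiting the ball infinitely often; these lie
      outside the realm of \<open>A\<close> and form a null set.\<close>
    have lim: "(\<lambda>n. measure lam (visits_from j n)) \<longlonglongrightarrow> measure lam (\<Inter>n. visits_from j n)"
    proof (rule finite_Lim_measure_decseq)
      show "range (visits_from j) \<subseteq> sets lam"
        unfolding sets using open_visits_from by (intro image_subsetI borel_open)
      show "decseq (visits_from j)"
        unfolding decseq_def visits_from_def by (auto intro: order_trans)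
    qed
    have "(\<Inter>n. visits_from j n) \<subseteq> space lam - realm T A"
    proof
      fix x assume x: "x \<in> (\<Inter>n. visits_from j n)"
      have "x \<notin> realm T A"
        using realm_eventually_avoids[OF _ closed_imp_compact[OF closed_ideal_cball] disj, of x] x
          ideal_ball_subset_cball[of s j]
        unfolding visits_from_def by blast
      then show "x \<in> space lam - realm T A"
        using sets_eq_imp_space_eq[OF sets] by simp
    qed
    then have "measure lam (\<Inter>n. visits_from j n) \<le> measure lam (space lam - realm T A)"
      by (rule finite_measure_mono) (simp add: sets borel_realm clo sets.compl_sets sets_eq_imp_space_eq[OF sets] Compl_eq_Diff_UNIV[symmetric] borel_comp)
    then have less: "measure lam (\<Inter>n. visits_from j n) < 1 / 2"
      using prob_compl[of "realm T A"] full borel_realm[OF clo] sets by simp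
    from lim less have "\<forall>\<^sub>F n in sequentially. measure lam (visits_from j n) < 1 / 2"
      by (rule order_tendstoD(2))
    then show "?Z j" by (auto simp: eventually_sequentially not_less intro: less_imp_le)
  qed
qed

text \<open>\<open>U\<close> itself need not be effective. A finite union \<open>K\<close> of closed
  ideal balls squeezed between the image of \<open>U\<close> and \<open>U\<close> has images
  interleaved with those of \<open>U\<close>, hence the same intersection \<open>A\<close>, and its
  list of balls can be written into the formula.\<close>

lemma strongly_attracting_Pi:
  assumes "closed A" "strongly_attracting T A" shows "Pi_compact s 1 A"
proof -
  obtain U where U: "open U" "A \<subseteq> U" "T ` closure U \<subseteq> U" "A = (\<Inter>n. (T ^^ n) ` U)"
    using assms(2) unfolding strongly_attracting_def by blast
  have T: "continuous_on S T" for S using continuous_on_funpow[of S 1] by simp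
  have "compact (T ` closure U)"
    by (intro compact_continuous_image T closed_imp_compact closed_closure)
  from compact_subset_open[OF this U(1,3)] obtain l where
    l: "T ` closure U \<subseteq> (\<Union>m\<in>set l. ideal_ball s m)" "(\<Union>m\<in>set l. ideal_cball s m) \<subseteq> U" by blast
  define K where "K = (\<Union>m\<in>set l. ideal_cball s m)"
  have TUK: "T ` U \<subseteq> K"
  proof -
    have "T ` U \<subseteq> T ` closure U" using closure_subset by (rule image_mono)
    also have "\<dots> \<subseteq> (\<Union>m\<in>set l. ideal_ball s m)" by (rule l(1))
    also have "\<dots> \<subseteq> K" unfolding K_def by (intro UN_mono ideal_ball_subset_cball) simp
    finally show ?thesis .
  qed
  have KU: "K \<subseteq> U" using l(2) unfolding K_def .
  have compK: "compact K" unfolding K_def by (intro compact_UN closed_imp_compact closed_ideal_cball) simp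
  have Suc_image: "(T ^^ Suc n) ` S = (T ^^ n) ` (T ` S)" for n S
    by (simp add: image_comp funpow_Suc_right del: funpow.simps)
  have A: "A = (\<Inter>n. (T ^^ n) ` K)"
  proof
    have "(T ^^ Suc n) ` U \<subseteq> (T ^^ n) ` K" for n
      unfolding Suc_image by (rule image_mono[OF TUK])
    then show "A \<subseteq> (\<Inter>n. (T ^^ n) ` K)" using U(4) by blast
    show "(\<Inter>n. (T ^^ n) ` K) \<subseteq> A" using KU U(4) by blast
  qed
  \<comment> \<open>The images decrease since \<open>K\<close> is mapped into itself, so compactness
    of a closed ball missing \<open>A\<close> yields a single image that it misses.\<close>
  have dec: "(T ^^ n) ` K \<subseteq> (T ^^ m) ` K" if "m \<le> n" for m n
    using that
  proof (induction n rule: dec_induct)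
    case (step n)
    have "(T ^^ Suc n) ` K \<subseteq> (T ^^ n) ` K"
      unfolding Suc_image using TUK KU by (intro image_mono) blast
    with step show ?case by blast
  qed simp
  have "ideal_cball s i \<inter> A = {} \<longleftrightarrow> (\<exists>n. \<forall>m\<in>set l. (T ^^ n) ` ideal_cball s m \<inter> ideal_cball s i = {})" for i
  proof -
    have "(\<exists>n. ideal_cball s i \<inter> (T ^^ n) ` K = {})" if "ideal_cball s i \<inter> A = {}"
    proof -
      have "ideal_cball s i \<subseteq> (\<Union>n. - (T ^^ n) ` K)" using that A by blast
      moreover have "open (- (T ^^ n) ` K)" for n
        by (intro open_Compl compact_imp_closed compact_continuous_image continuous_on_funpow compK)
      ultimately obtain N where N: "finite N" "ideal_cball s i \<subseteq> (\<Union>n\<in>N. - (T ^^ n) ` K)"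
        using compactE_image[OF closed_imp_compact[OF closed_ideal_cball, of s i], of UNIV "\<lambda>n. - (T ^^ n) ` K"] by metis
      obtain b where b: "\<forall>n\<in>N. n \<le> b" using N(1) finite_nat_set_iff_bounded_le by blast
      then have "ideal_cball s i \<inter> (T ^^ b) ` K = {}" using N(2) dec by blast
      then show ?thesis by blast
    qed
    moreover have "ideal_cball s i \<inter> A = {}" if "ideal_cball s i \<inter> (T ^^ n) ` K = {}" for n
      using that A by blast
    moreover have "ideal_cball s i \<inter> (T ^^ n) ` K = {} \<longleftrightarrow> (\<forall>m\<in>set l. (T ^^ n) ` ideal_cball s m \<inter> ideal_cball s i = {})" for n
      unfolding K_def image_UN by blast
    ultimately show ?thesis by metis
  qed
  moreover have "sigma 1 (\<lambda>i. \<exists>n. \<forall>m\<in>set l. (T ^^ n) ` ideal_cball s m \<inter> ideal_cball s i = {})"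
    by (intro sigma_intros computable_intros)
  ultimately show ?thesis
    unfolding Pi_compact_def Sigma_set_iff_sigma using closed_imp_compact[OF assms(1)] by simp
qed

section \<open>Inner collections from outer collections\<close>

lemma Sigma_of_Pi:
  assumes A: "A \<noteq> {}" "Pi_compact s n A" "n \<noteq> 0"
    and E: "sigma 1 (\<lambda>p. E (fst (prod_decode p)) (snd (prod_decode p)))"
    and iff: "\<And>i. ideal_ball s i \<inter> A \<noteq> {} \<longleftrightarrow> A \<subseteq> balls s (\<lambda>m. E m i)"
  shows "Sigma_compact s n A"
proof -
  have comp: "compact A" and out: "sigma n (\<lambda>m. ideal_cball s m \<inter> A = {})"
    using A(2) unfolding Pi_compact_def Sigma_set_iff_sigma by simp_all
  \<comment> \<open>The balls of the outer collection fill the complement of \<open>A\<close>.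
    Adding them to \<open>E\<close> turns the inclusion into a covering of the whole space;
    \<open>E\<close> is Sigma_1 and the outer collection Sigma_n, so the level is
    \<open>n\<close>.\<close>
  have "A \<subseteq> balls s (\<lambda>m. E m i) \<longleftrightarrow> balls s (\<lambda>m. E m i \<or> ideal_cball s m \<inter> A = {}) = UNIV" for i
  proof -
    have "balls s (\<lambda>m. ideal_cball s m \<inter> A = {}) = - A"
      using open_contains_ideal_cball[of "- A"] compact_imp_closed[OF comp] ideal_ball_subset_cball
      by (fastforce simp: mem_balls)
    moreover have "balls s (\<lambda>m. E m i \<or> ideal_cball s m \<inter> A = {}) =
        balls s (\<lambda>m. E m i) \<union> balls s (\<lambda>m. ideal_cball s m \<inter> A = {})"
      by (auto simp: balls_def)
    ultimately show ?thesis by blast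
  qed
  moreover have "sigma n (\<lambda>i. balls s (\<lambda>m. E m i \<or> ideal_cball s m \<inter> A = {}) = UNIV)"
    by (intro sigma_balls_UNIV sigma_disj sigma_of_sigma_1[OF E A(3)] sigma_compose[OF out] computable_intros A(3))
  ultimately show ?thesis
    unfolding Sigma_compact_def Sigma_set_iff_sigma using comp by (simp add: iff)
qed

text \<open>The empty set lies in every union of balls although no ball meets it, so the covering
  criterion cannot hold for it.\<close>

lemma Sigma_compact_empty: "Sigma_compact s n ({} :: 'a set)"
  unfolding Sigma_compact_def Sigma_set_iff_sigma
  by (simp add: sigma_decidable decidable_intros)

lemma minimal_Sigma:
  assumes inv: "T ` A \<subseteq> A" and "Pi_compact s n A" "n \<noteq> 0" and minimal: "minimal_on T A"
  shows "Sigma_compact s n A"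
proof (cases "A = {}")
  case False
  have inv: "(T ^^ k) x \<in> A" if "x \<in> A" for x k
    using that by (induction k) (use inv in auto)
  show ?thesis
  proof (rule Sigma_of_Pi[OF False assms(2,3)])
    show "sigma 1 (\<lambda>e. \<exists>k. (snd (prod_decode e), fst (prod_decode e)) \<in> enum_rel p ^^ k)"
      by (intro sigma_intros computable_intros)
    fix i
    have "x \<in> balls s (\<lambda>m. \<exists>k. (i, m) \<in> enum_rel p ^^ k) \<longleftrightarrow> (\<exists>k. (T ^^ k) x \<in> ideal_ball s i)" for x
      unfolding funpow_in_ideal_ball mem_balls by blast
    then have iff: "A \<subseteq> balls s (\<lambda>m. \<exists>k. (i, m) \<in> enum_rel p ^^ k) \<longleftrightarrow> (\<forall>x\<in>A. \<exists>k. (T ^^ k) x \<in> ideal_ball s i)"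
      by blast
    show "ideal_ball s i \<inter> A \<noteq> {} \<longleftrightarrow> A \<subseteq> balls s (\<lambda>m. \<exists>k. (i, m) \<in> enum_rel p ^^ k)"
      unfolding iff
    proof
      assume ne: "ideal_ball s i \<inter> A \<noteq> {}"
      show "\<forall>x\<in>A. \<exists>k. (T ^^ k) x \<in> ideal_ball s i"
      proof
        fix x assume "x \<in> A"
        then have "ideal_ball s i \<inter> closure (range (\<lambda>n. (T ^^ n) x)) \<noteq> {}"
          using ne minimal unfolding minimal_on_def by blast
        then show "\<exists>k. (T ^^ k) x \<in> ideal_ball s i"
          using open_Int_closure_eq_empty[OF open_ideal_ball] by blast
      qed
    next
      assume "\<forall>x\<in>A. \<exists>k. (T ^^ k) x \<in> ideal_ball s i"
      \<comment> \<open>A single point of \<open>A\<close> is enough for the converse: by invariance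
        its visit to the ball takes place inside \<open>A\<close>.\<close>
      with False obtain x k where "x \<in> A" "(T ^^ k) x \<in> ideal_ball s i" by blast
      then show "ideal_ball s i \<inter> A \<noteq> {}" using inv by blast
    qed
  qed
qed (simp add: Sigma_compact_empty)

text \<open>Images of the whole ball are taken, so a point of \<open>A\<close> might be reached from
  outside \<open>A\<close>. Invariance under preimages excludes this: a source point in the ball is
  itself in \<open>A\<close>, which gives the converse half of the criterion.\<close>

lemma exact_Sigma:
  assumes "effectively_open s T" and inv: "T -` A = A" and "Pi_compact s n A" "n \<noteq> 0"
    and exact: "exact_on T A"
  shows "Sigma_compact s n A"
proof (cases "A = {}")
  case False
  obtain q where q: "\<And>m. T ` ideal_ball s m = (\<Union>i\<in>enumerated q m. ideal_ball s i)"
    using assms(1) unfolding effectively_open_def by blast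
  have inv: "(T ^^ k) x \<in> A \<longleftrightarrow> x \<in> A" for x k
    by (induction k) (use inv in auto)
  show ?thesis
  proof (rule Sigma_of_Pi[OF False assms(3,4)])
    show "sigma 1 (\<lambda>e. \<exists>k. (snd (prod_decode e), fst (prod_decode e)) \<in> enum_rel q ^^ k)"
      by (intro sigma_intros computable_intros)
    fix i
    have "x \<in> balls s (\<lambda>m. \<exists>k. (i, m) \<in> enum_rel q ^^ k) \<longleftrightarrow> (\<exists>k. x \<in> (T ^^ k) ` ideal_ball s i)" for x
      unfolding funpow_image_ideal_ball[OF q] mem_balls by blast
    then have iff: "A \<subseteq> balls s (\<lambda>m. \<exists>k. (i, m) \<in> enum_rel q ^^ k) \<longleftrightarrow>
        (\<forall>x\<in>A. \<exists>k. x \<in> (T ^^ k) ` ideal_ball s i)"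
      by blast
    show "ideal_ball s i \<inter> A \<noteq> {} \<longleftrightarrow> A \<subseteq> balls s (\<lambda>m. \<exists>k. (i, m) \<in> enum_rel q ^^ k)"
      unfolding iff
    proof
      assume "ideal_ball s i \<inter> A \<noteq> {}"
      then obtain k where "A \<subseteq> (T ^^ k) ` ideal_ball s i"
        using exact radius_pos[of i] unfolding exact_on_def ideal_ball_def by blast
      then show "\<forall>x\<in>A. \<exists>k. x \<in> (T ^^ k) ` ideal_ball s i" by blast
    next
      assume "\<forall>x\<in>A. \<exists>k. x \<in> (T ^^ k) ` ideal_ball s i"
      moreover obtain x where "x \<in> A" using False by blast
      ultimately obtain k where "x \<in> (T ^^ k) ` ideal_ball s i" by blast
      with \<open>x \<in> A\<close> obtain y where "y \<in> ideal_ball s i" "(T ^^ k) y \<in> A" by blast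
      then show "ideal_ball s i \<inter> A \<noteq> {}" using inv by blast
    qed
  qed
qed (simp add: Sigma_compact_empty)

section \<open>Visit frequencies and statistical attractors\<close>

text \<open>The proportion of visits before time \<open>n\<close> is below
  \<open>1 / (q + 1)\<close>, written without division; for \<open>n = 0\<close> the set is empty.
  Counting visits to a closed ball makes this an open condition on the point.\<close>

definition rare_visits :: "nat \<Rightarrow> nat \<Rightarrow> nat \<Rightarrow> 'a set" where
  "rare_visits j q n = {x. Suc q * card {k. k < n \<and> (T ^^ k) x \<in> ideal_cball s j} < n}"

text \<open>\<open>c\<close> lists \<open>d\<close> distinct times before \<open>n\<close> at which the orbit of the whole ball avoids the closed ball \<open>j\<close>.\<close>

lemma rare_visits_eq_balls:
  "rare_visits j q n = balls s (\<lambda>m. \<exists>c d. (\<forall>a<d. code_nth c a < n \<and>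
      (T ^^ code_nth c a) ` ideal_cball s m \<inter> ideal_cball s j = {} \<and>
      (\<forall>b<a. code_nth c b \<noteq> code_nth c a)) \<and> Suc q * n < n + Suc q * d)"
  (is "_ = balls s ?E")
proof (intro set_eqI iffI)
  fix x
  let ?V = "{k. k < n \<and> (T ^^ k) x \<in> ideal_cball s j}"
  let ?D = "{k. k < n \<and> (T ^^ k) x \<notin> ideal_cball s j}"
  \<comment> \<open>Visits and avoidances add up to \<open>n\<close>, so few visits means many
    avoidances; the inequality with \<open>d\<close> in \<open>?E\<close> is this restatement
    without subtraction.\<close>
  have "card ?D + card ?V = card (?D \<union> ?V)" by (rule card_Un_disjoint[symmetric]) auto
  also have "?D \<union> ?V = {..<n}" by auto
  finally have card: "card ?D + card ?V = n" by simp
  show "x \<in> balls s ?E" if "x \<in> rare_visits j q n"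
  proof -
    have fin: "finite ?D" by simp
    define l where "l = sorted_list_of_set ?D"
    have l: "set l = ?D" "distinct l" "length l = card ?D" using fin by (auto simp: l_def)
    \<comment> \<open>Finitely many avoidances persist near \<open>x\<close>, so one closed ideal
      ball around \<open>x\<close> avoids the closed ball \<open>j\<close> at all these
      times.\<close>
    have "open (\<Inter>k\<in>?D. (T ^^ k) -` (- ideal_cball s j))"
      by (intro open_INT fin ballI open_funpow_vimage open_Compl closed_ideal_cball)
    moreover have "x \<in> (\<Inter>k\<in>?D. (T ^^ k) -` (- ideal_cball s j))" by simp
    ultimately obtain m where m: "x \<in> ideal_ball s m"
      "ideal_cball s m \<subseteq> (\<Inter>k\<in>?D. (T ^^ k) -` (- ideal_cball s j))"
      using open_contains_ideal_cball by meson
    have less: "Suc q * n < n + Suc q * length l"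
    proof -
      have "Suc q * n = Suc q * length l + Suc q * card ?V"
        by (simp only: l(3) card distrib_left[symmetric])
      also have "\<dots> < Suc q * length l + n" using that by (simp only: rare_visits_def mem_Collect_eq add_less_cancel_left)
      finally show ?thesis by simp
    qed
    have times: "code_nth (list_encode l) a < n \<and>
      (T ^^ code_nth (list_encode l) a) ` ideal_cball s m \<inter> ideal_cball s j = {} \<and>
      (\<forall>b<a. code_nth (list_encode l) b \<noteq> code_nth (list_encode l) a)" if a: "a < length l" for a
    proof -
      have la: "l ! a \<in> ?D" using nth_mem[OF a] l(1) by simp
      moreover have "(T ^^ (l ! a)) ` ideal_cball s m \<inter> ideal_cball s j = {}" using m(2) la by blast
      moreover have "l ! b \<noteq> l ! a" if "b < a" for b
        using nth_eq_iff_index_eq[OF l(2), of b a] a that by simp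
      ultimately show ?thesis using a by (simp add: code_nth_list_encode)
    qed
    have "?E m"
      by (intro exI[of _ "list_encode l"] exI[of _ "length l"] conjI[OF _ less] allI impI times)
    with m(1) show ?thesis by (auto simp: mem_balls)
  qed
  show "x \<in> rare_visits j q n" if "x \<in> balls s ?E"
  proof -
    from that obtain m where x: "x \<in> ideal_ball s m" and m: "?E m"
      unfolding mem_balls by blast
    from m obtain c d where c: "\<And>a. a < d \<Longrightarrow> code_nth c a < n" "\<And>a. a < d \<Longrightarrow> (T ^^ code_nth c a) ` ideal_cball s m \<inter> ideal_cball s j = {}"
      and dist: "\<And>a b. a < d \<Longrightarrow> b < a \<Longrightarrow> code_nth c b \<noteq> code_nth c a"
      and less: "Suc q * n < n + Suc q * d"
      by (elim exE conjE) blast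
    have "inj_on (code_nth c) {..<d}"
      using dist by (intro linorder_inj_onI) (metis lessThan_iff, simp add: linear)
    then have "d = card (code_nth c ` {..<d})" by (simp add: card_image)
    also have "\<dots> \<le> card ?D"
    proof (rule card_mono)
      show "code_nth c ` {..<d} \<subseteq> ?D"
        using c x ideal_ball_subset_cball[of s m] by blast
    qed simp
    finally have "Suc q * d + Suc q * card ?V \<le> Suc q * (card ?D + card ?V)"
      by (simp only: distrib_left[symmetric] mult_le_cancel1 add_le_cancel_right) simp
    with less show ?thesis unfolding card rare_visits_def mem_Collect_eq by linarith
  qed
qed

lemma open_rare_visits: "open (rare_visits j q n)"
  unfolding rare_visits_eq_balls by (rule open_balls)

lemma integral_empirical_measure:
  fixes f :: "'a \<Rightarrow> real"
  assumes "continuous_on UNIV f"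
  shows "integral\<^sup>L (empirical_measure T x n) f = (\<Sum>k<n. f ((T ^^ k) x)) / real n"
proof -
  have "(\<lambda>i. (T ^^ i) x) \<in> uniform_count_measure {..<n} \<rightarrow>\<^sub>M borel"
    by (simp add: uniform_count_measure_def point_measure_def)
  then show ?thesis
    unfolding empirical_measure_def using assms
    by (simp add: integral_distr borel_measurable_continuous_onI integral_uniform_count_measure)
qed

end

text \<open>A continuous substitute for an indicator, to which weak* convergence applies: for
  \<open>a < b\<close> it falls from 1 on the closed ball of radius \<open>a\<close> to 0 outside
  the open ball of radius \<open>b\<close>.\<close>

definition tent :: "real \<Rightarrow> real \<Rightarrow> 'a::metric_space \<Rightarrow> 'a \<Rightarrow> real" where
  "tent a b c z = max 0 (min 1 ((b - dist c z) / (b - a)))"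

lemma
  assumes "a < b"
  shows continuous_on_tent: "continuous_on S (tent a b c)"
    and tent_nonneg: "0 \<le> tent a b c z"
    and tent_le_1: "tent a b c z \<le> 1"
    and tent_eq_1: "dist c z \<le> a \<Longrightarrow> tent a b c z = 1"
    and tent_eq_0: "b \<le> dist c z \<Longrightarrow> tent a b c z = 0"
    and bounded_tent: "bounded (range (tent a b c))"
proof -
  show "continuous_on S (tent a b c)"
    unfolding tent_def[abs_def] using assms by (intro continuous_intros) auto
  show b: "0 \<le> tent a b c z" "tent a b c z \<le> 1" for z by (simp_all add: tent_def)
  show "dist c z \<le> a \<Longrightarrow> tent a b c z = 1" "b \<le> dist c z \<Longrightarrow> tent a b c z = 0"
    using assms by (auto simp: tent_def divide_nonpos_pos)
  show "bounded (range (tent a b c))"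
    unfolding bounded_iff using b by (intro exI[of _ 1]) auto
qed

text \<open>Dominated convergence for indicators. It trades an almost sure statement about eventual
  behaviour for inequalities between measures at each late \<open>n\<close>, which a formula over
  ideal balls can express.\<close>

lemma (in prob_space) prob_tendsto_0:
  assumes E: "\<And>n. E n \<in> events" and "AE x in M. \<forall>\<^sub>F n in sequentially. x \<notin> E n"
  shows "(\<lambda>n. prob (E n)) \<longlonglongrightarrow> 0"
proof -
  have "(\<lambda>n. integral\<^sup>L M (indicator (E n) :: _ \<Rightarrow> real)) \<longlonglongrightarrow> integral\<^sup>L M (\<lambda>x. 0 :: real)"
  proof (rule integral_dominated_convergence[where w = "\<lambda>_. 1"])
    show "AE x in M. (\<lambda>n. indicator (E n) x :: real) \<longlonglongrightarrow> 0"
      using assms(2)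
    proof (rule AE_mp, intro AE_I2 impI)
      fix x assume "\<forall>\<^sub>F n in sequentially. x \<notin> E n"
      then have "\<forall>\<^sub>F n in sequentially. indicator (E n) x = (0 :: real)"
        by (rule eventually_mono) simp
      then show "(\<lambda>n. indicator (E n) x :: real) \<longlonglongrightarrow> 0" by (rule tendsto_eventually)
    qed
  qed (use E in \<open>auto simp: indicator_def\<close>)
  then show ?thesis using E sets.Int_space_eq2 by (simp add: E)
qed

text \<open>Every point outside the support lies in a null ideal ball, and there are only countably
  many ideal balls, so the union of the null ones is null.\<close>

lemma (in recursively_compact_space) measure_0_of_disjoint_support:
  fixes M :: "'a measure"
  assumes M: "borel_prob M" and disj: "ideal_ball s i \<inter> measure_support M = {}"
  shows "measure M (ideal_ball s i) = 0"
proof -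
  interpret prob_space M using M by (simp add: borel_prob_def)
  have sets: "open U \<Longrightarrow> U \<in> sets M" for U using M by (simp add: borel_prob_def)
  have "ideal_ball s i \<subseteq> balls s (\<lambda>m. measure M (ideal_ball s m) = 0)"
  proof
    fix x assume "x \<in> ideal_ball s i"
    with disj obtain U where U: "open U" "x \<in> U" "\<not> measure M U > 0"
      unfolding measure_support_def by blast
    obtain m where m: "x \<in> ideal_ball s m" "ideal_cball s m \<subseteq> U"
      using open_contains_ideal_cball[OF U(1,2)] by blast
    have "measure M (ideal_ball s m) \<le> measure M U"
      by (rule finite_measure_mono) (use m(2) ideal_ball_subset_cball[of s m] sets[OF U(1)] in auto)
    then have "measure M (ideal_ball s m) = 0"
      using U(3) measure_nonneg[of M "ideal_ball s m"] by linarith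
    with m(1) show "x \<in> balls s (\<lambda>m. measure M (ideal_ball s m) = 0)" by (auto simp: mem_balls)
  qed
  then have "measure M (ideal_ball s i) \<le> measure M (balls s (\<lambda>m. measure M (ideal_ball s m) = 0))"
    by (rule finite_measure_mono) (intro sets open_balls)
  moreover have "balls s (\<lambda>m. measure M (ideal_ball s m) = 0) \<in> null_sets M"
    unfolding balls_def
    by (rule null_sets_UN') (auto simp: null_sets_def emeasure_eq_measure intro!: sets open_ideal_ball)
  then have "measure M (balls s (\<lambda>m. measure M (ideal_ball s m) = 0)) = 0"
    by (rule measure_eq_0_null_sets)
  ultimately show ?thesis using measure_nonneg[of M "ideal_ball s i"] by linarith
qed

lemma sum_if_eq_card: "(\<Sum>k<n::nat. if P k then 1 else 0) = real (card {k. k < n \<and> P k})"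
  by (subst sum.If_cases) (auto simp: Collect_conj_eq lessThan_def)

context computable_system
begin

text \<open>Both directions compare orbit averages of a tent function with its integral. For a ball
  meeting \<open>A\<close> the tent lies below the indicator of the closed ball \<open>j\<close>;
  for a ball missing \<open>A\<close> it lies above that indicator and vanishes outside the ball
  \<open>i\<close>.\<close>

lemma statistical_attractor_Sigma:
  assumes lam: "computable_measure s lam" and "statistical_attractor lam T A"
  shows "Sigma_compact s 2 A"
proof -
  obtain M where M: "borel_prob M" "measure_support M = A"
    and lim: "AE x in lam. weak_star_limit (empirical_measure T x) M" and clo: "closed A"
    using assms(2) unfolding statistical_attractor_def by blast
  interpret L: prob_space lam using lam by (simp add: computable_measure_def borel_prob_def)
  interpret M: prob_space M using M by (simp add: borel_prob_def)
  have setsL: "sets lam = sets borel" using lam by (simp add: computable_measure_def borel_prob_def)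
  have setsM: "sets M = sets borel" using M by (simp add: borel_prob_def)
  have meas: "rare_visits j q n \<in> sets lam" for j q n
    unfolding setsL by (intro borel_open open_rare_visits)
  have avg: "AE x in lam. (\<lambda>n. (\<Sum>k<n. tent a b c ((T ^^ k) x)) / real n) \<longlonglongrightarrow> integral\<^sup>L M (tent a b c)"
    if "a < b" for a b c
    using lim
  proof (rule AE_mp, intro AE_I2 impI)
    fix x assume "weak_star_limit (empirical_measure T x) M"
    then have "(\<lambda>n. integral\<^sup>L (empirical_measure T x n) (tent a b c)) \<longlonglongrightarrow> integral\<^sup>L M (tent a b c)"
      unfolding weak_star_limit_def
      using continuous_on_tent[OF that, of UNIV c] bounded_tent[OF that, of c] by blast
    then show "(\<lambda>n. (\<Sum>k<n. tent a b c ((T ^^ k) x)) / real n) \<longlonglongrightarrow> integral\<^sup>L M (tent a b c)"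
      unfolding integral_empirical_measure[OF continuous_on_tent[OF that]] .
  qed
  have int: "integrable M (tent a b c)" if "a < b" for a b c
  proof (rule M.integrable_const_bound[of _ 1])
    show "AE z in M. norm (tent a b c z) \<le> 1"
      by (intro AE_I2) (simp add: tent_nonneg[OF that] tent_le_1[OF that])
    show "tent a b c \<in> borel_measurable M"
      unfolding measurable_cong_sets[OF setsM refl]
      by (rule borel_measurable_continuous_onI[OF continuous_on_tent[OF that]])
  qed
  have ball: "ball c r \<in> sets M" for c r unfolding setsM by simp
  have "ideal_ball s i \<inter> A \<noteq> {} \<longleftrightarrow> (\<exists>j q N. centre i = centre j \<and> radius j < radius i \<and>
      \<not> (\<exists>n. N \<le> n \<and> 1 / 2 < measure lam (rare_visits j q n)))" (is "_ \<longleftrightarrow> ?R") for i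
  proof
    let ?c = "s (centre i)"
    assume "ideal_ball s i \<inter> A \<noteq> {}"
    then obtain y where y: "dist ?c y < radius i" "y \<in> A" by (auto simp: ideal_ball_def)
    \<comment> \<open>The midpoint: the ball of radius \<open>r\<close> contains a point of the
      support, so it has positive mass, and room is left for \<open>radius j\<close> between
      \<open>r\<close> and \<open>radius i\<close>.\<close>
    define r where "r = (dist ?c y + radius i) / 2"
    have r: "0 \<le> r" "dist ?c y < r" "r < radius i" using y(1) radius_pos[of i] by (auto simp: r_def)
    obtain j where j: "centre j = centre i" "r < radius j" "radius j < radius i"
      using exists_concentric[OF r(1,3)] by blast
    let ?f = "tent r (radius j) ?c"
    have "0 < measure M (ball ?c r)"
      using y(2) r(2) unfolding M(2)[symmetric] measure_support_def by simp
    also have "\<dots> = integral\<^sup>L M (indicator (ball ?c r))" using ball by (simp add: setsM)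
    also have "\<dots> \<le> integral\<^sup>L M ?f"
    proof (rule integral_mono)
      show "indicator (ball ?c r) z \<le> ?f z" for z
        using tent_eq_1[OF j(2), of ?c z] tent_nonneg[OF j(2), of ?c z]
        by (cases "dist ?c z < r") auto
    qed (use ball int[OF j(2)] in \<open>auto simp: M.emeasure_eq_measure\<close>)
    \<comment> \<open>The tent averages converge to a positive number; \<open>q\<close> is chosen so
      that \<open>1 / (q + 1)\<close> lies strictly below it.\<close>
    finally obtain q where q: "1 / real (Suc q) < integral\<^sup>L M ?f"
      using nat_approx_posE by metis
    have "AE x in lam. \<forall>\<^sub>F n in sequentially. x \<notin> rare_visits j q n"
      using avg[OF j(2), of ?c]
    proof (rule AE_mp, intro AE_I2 impI)
      fix x assume "(\<lambda>n. (\<Sum>k<n. ?f ((T ^^ k) x)) / real n) \<longlonglongrightarrow> integral\<^sup>L M ?f"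
      from order_tendstoD(1)[OF this q] eventually_gt_at_top[of 0]
      show "\<forall>\<^sub>F n in sequentially. x \<notin> rare_visits j q n"
      proof eventually_elim
        case (elim n)
        have "?f z \<le> (if z \<in> ideal_cball s j then 1 else 0)" for z
          using tent_le_1[OF j(2), of ?c z] tent_eq_0[OF j(2), of ?c z] j(1)
          by (cases "dist ?c z \<le> radius j") (auto simp: ideal_cball_def)
        then have "(\<Sum>k<n. ?f ((T ^^ k) x)) \<le> (\<Sum>k<n. if (T ^^ k) x \<in> ideal_cball s j then 1 else 0)"
          by (intro sum_mono)
        with elim have "real n < real (Suc q) * real (card {k. k < n \<and> (T ^^ k) x \<in> ideal_cball s j})"
          unfolding sum_if_eq_card by (simp add: field_simps) (smt (verit) mult_left_mono of_nat_0_le_iff)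
        then show ?case
          unfolding rare_visits_def mem_Collect_eq of_nat_mult[symmetric] of_nat_less_iff by simp
      qed
    qed
    from L.prob_tendsto_0[OF meas this]
    have "\<forall>\<^sub>F n in sequentially. measure lam (rare_visits j q n) < 1 / 2"
      by (rule order_tendstoD(2)) simp
    then obtain N where "\<forall>n\<ge>N. measure lam (rare_visits j q n) < 1 / 2"
      unfolding eventually_sequentially by blast
    then have "\<not> (\<exists>n. N \<le> n \<and> 1 / 2 < measure lam (rare_visits j q n))"
      using less_asym by blast
    with j show ?R by metis
  next
    let ?c = "s (centre i)"
    assume ?R
    then obtain j q N where j: "centre i = centre j" "radius j < radius i"
      and N: "\<And>n. N \<le> n \<Longrightarrow> \<not> 1 / 2 < measure lam (rare_visits j q n)" by blast
    show "ideal_ball s i \<inter> A \<noteq> {}"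
    proof
      assume "ideal_ball s i \<inter> A = {}"
      then have 0: "measure M (ideal_ball s i) = 0"
        using measure_0_of_disjoint_support[OF M(1)] M(2) by blast
      let ?f = "tent (radius j) (radius i) ?c"
      have "integral\<^sup>L M ?f \<le> integral\<^sup>L M (indicator (ball ?c (radius i)))"
      proof (rule integral_mono)
        show "?f z \<le> indicator (ball ?c (radius i)) z" for z
          using tent_le_1[OF j(2), of ?c z] tent_eq_0[OF j(2), of ?c z]
          by (cases "dist ?c z < radius i") auto
      qed (use ball int[OF j(2)] in \<open>auto simp: M.emeasure_eq_measure\<close>)
      also have "\<dots> = 0" using 0 ball by (simp add: ideal_ball_def setsM)
      \<comment> \<open>The tent vanishes outside a ball of measure 0, so the averages tend to 0 and
        fall below \<open>1 / (q + 1)\<close> whatever \<open>q\<close> was given.\<close>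
      finally have less: "integral\<^sup>L M ?f < 1 / real (Suc q)"
        by (rule le_less_trans) simp
      have "AE x in lam. \<forall>\<^sub>F n in sequentially. x \<notin> space lam - rare_visits j q n"
        using avg[OF j(2), of ?c]
      proof (rule AE_mp, intro AE_I2 impI)
        fix x assume "(\<lambda>n. (\<Sum>k<n. ?f ((T ^^ k) x)) / real n) \<longlonglongrightarrow> integral\<^sup>L M ?f"
        from order_tendstoD(2)[OF this less] eventually_gt_at_top[of 0]
        show "\<forall>\<^sub>F n in sequentially. x \<notin> space lam - rare_visits j q n"
        proof eventually_elim
          case (elim n)
          have "(if z \<in> ideal_cball s j then 1 else 0) \<le> ?f z" for z
            using tent_nonneg[OF j(2), of ?c z] tent_eq_1[OF j(2), of ?c z] j(1)
            by (cases "dist ?c z \<le> radius j") (auto simp: ideal_cball_def)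
          then have "(\<Sum>k<n. if (T ^^ k) x \<in> ideal_cball s j then 1 else 0) \<le> (\<Sum>k<n. ?f ((T ^^ k) x))"
            by (intro sum_mono)
          with elim have "real (Suc q) * real (card {k. k < n \<and> (T ^^ k) x \<in> ideal_cball s j}) < real n"
            unfolding sum_if_eq_card by (simp add: field_simps) (smt (verit) mult_left_mono of_nat_0_le_iff)
          then show ?case
            unfolding rare_visits_def Diff_iff mem_Collect_eq of_nat_mult[symmetric] of_nat_less_iff by simp
        qed
      qed
      from L.prob_tendsto_0[OF sets.compl_sets[OF meas] this]
      have "\<forall>\<^sub>F n in sequentially. measure lam (space lam - rare_visits j q n) < 1 / 2"
        by (rule order_tendstoD(2)) simp
      then obtain N' where N': "\<And>n. n \<ge> N' \<Longrightarrow> measure lam (space lam - rare_visits j q n) < 1 / 2"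
        unfolding eventually_sequentially by blast
      \<comment> \<open>At a common late time the set would have measure at most 1/2 and its
        complement less than 1/2, while the two add up to 1.\<close>
      show False
        using N[of "max N N'"] N'[of "max N N'"] L.prob_compl[OF meas, of j q "max N N'"] by simp
    qed
  qed
  moreover have "sigma 2 (\<lambda>i. \<exists>j q N. centre i = centre j \<and> radius j < radius i \<and>
      \<not> (\<exists>n. N \<le> n \<and> 1 / 2 < measure lam (rare_visits j q n)))"
    unfolding rare_visits_eq_balls
    by (intro sigma_ex sigma_conj one_two_neq_0 sigma_2_not sigma_less_half_measure[OF lam];
      intro sigma_intros sigma_decidable decidable_intros computable_rat_intros computable_intros)
  ultimately show ?thesis
    unfolding Sigma_compact_def Sigma_set_iff_sigma using closed_imp_compact[OF clo] by simp
qed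

end

theorem theorem1:
  fixes s :: "nat \<Rightarrow> 'a::metric_space"
    and T :: "'a \<Rightarrow> 'a"
    and lam :: "'a measure"
    and A :: "'a set"
  assumes "computable_metric_space s"
    and "recursively_compact s (UNIV :: 'a set)"
    and "computable_map s T"
    and "computable_measure s lam"
    and "closed A"
    and "T ` A \<subseteq> A"
  shows "(topological_attractor T A \<longrightarrow> Pi_compact s 2 A)
    \<and> (metric_attractor lam T A \<longrightarrow> Pi_compact s 2 A)
    \<and> (statistical_attractor lam T A \<longrightarrow> Sigma_compact s 2 A)
    \<and> (strongly_attracting T A \<longrightarrow> Pi_compact s 1 A)
    \<and> (\<forall>n\<in>{1, 2}. Pi_compact s n A \<longrightarrow>
          (minimal_on T A \<longrightarrow> Sigma_compact s n A)
        \<and> (effectively_open s T \<and> T -` A = A \<and> exact_on T A \<longrightarrow> Sigma_compact s n A))"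
proof -
  obtain p where "\<forall>m. T -` ideal_ball s m = (\<Union>i\<in>enumerated p m. ideal_ball s i)"
    using assms(3) unfolding computable_map_def by blast
  with assms(1,2) interpret computable_system s T p
    by unfold_locales blast+
  show ?thesis
    using topological_attractor_Pi metric_attractor_Pi[OF assms(4)] statistical_attractor_Sigma[OF assms(4)]
      strongly_attracting_Pi[OF assms(5)] minimal_Sigma[OF assms(6)] exact_Sigma
    by auto
qed

end
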